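(* Let $\mathcal R$ and $\mathcal V$ be monads in $\mathbf{SANMND}$ and let $\tau:\mathcal R\to\mathcal V$ be an arbitrary morphism of monads on $\mathbf{Set}$ (a natural transformation compatible with units and multiplications). Then $\tau$ is semi-cartesian if and only if the induced functor $\mathcal{EM}(\tau):\mathcal{EM}(\mathcal V)\to\mathcal{EM}(\mathcal R)$ between categories of algebras preserves Płonka sums (indexed by the categories of infinitary regular polynomials over suplattices).
   Context: A cardinal is the least ordinal of its cardinality; for a cardinal $\kappa$, $(\kappa]=\{1,\dots,\kappa\}$ is the standard set of cardinality $\kappa$ and $S_\kappa$ its permutation group. $\mathbb S_\infty$ is the category whose objects are all cardinals and whose morphisms $\kappa\to\kappa'$ are surjections $(\kappa]\to(\kappa']$. For $R:\mathbb S_\infty\to\mathbf{Set}$, $R_\kappa=R(\kappa)$, define $$\mathcal R(X)=\sum_{\kappa}\mathrm{Inj}((\kappa],X)\otimes_\kappa R_\kappa$$ (sum over all cardinals; terms with $\kappa>\mathrm{card}(X)$ are empty), where $\otimes_\kappa$ is the quotient of the product by $\langle\vec x\circ\sigma,r\rangle\sim\langle\vec x,R(\sigma)(r)\rangle$, $\sigma\in S_\kappa$. The class of $\langle\vec x,r\rangle$ is $[\vec x,r]$, and $\mathcal R(f)([\vec x,r])=[\vec y,R(s)(r)]$, where $f\circ\vec x=\vec y\circ s$ with $s:(\kappa]\to(\kappa']$ surjective and $\vec y$ injective. $\mathbf{SAN}$ consists of the endofunctors of $\mathbf{Set}$ isomorphic to such an $\mathcal R$. For an arbitrary function $\vec x:(\kappa]\to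 X$ and $r\in R_\kappa$ put $\langle\!\langle\vec x,r\rangle\!\rangle=\mathcal R(\vec x)([1_{(\kappa]},r])$. A natural transformation is semi-cartesian if its naturality squares at injections are pullbacks. $\mathbf{SANMND}$ is the category of monads on $\mathbf{Set}$ whose functor part is in $\mathbf{SAN}$ and whose unit and multiplication are semi-cartesian, with semi-cartesian monad morphisms. $\mathcal{EM}(\mathcal R)$ is the Eilenberg-Moore category, and $\mathcal{EM}(\tau)$ sends $(B,\beta)$ to $(B,\beta\circ\tau_B)$. The terminal object of $\mathbf{SANMND}$ is the power-set monad, whose algebras are suplattices (posets with all joins); its coefficient functor is constantly a one-element set. Płonka sums here are those induced by the unique morphisms in $\mathbf{SANMND}$ from $\mathcal R$ and $\mathcal V$ to the power-set monad. Explicitly: Category of (infinitary) regular polynomials of a suplattice $A$. $\mathbf A=CP_{\infty r}(A)$ has the elements of $A$ as objects; a morphism $u\to v$ is a pair $(U,u)$ with $U\subseteq A$ any subset, $u\in U$ and $\bigvee U=v$; the identity of $u$ is $(\{u\},u)$; the composite of $(U,u):u\to v$ followed by $(U',v):v\to w$ is $(U\cup(U'\setminus\{v\}),u):u\to w$. The transformation $\lambda^{\mathcal R}$. For a functor $F:\mathbf A\to\mathbf{Set}$ and $[\vec x,r]\in\mathcal R(\coprod_{a\in A}F(a))$, $r\in R_\kappa$, let $p:\coprod_{a\in A}F(a)\to A$ be the projection to the index set, $U=\{p(\vec x(i)):i\in(\kappa]\}$, $b=\bigvee U$ and $\psi_i=(U,p(\vec x(i))):p(\vec x(i))\to b$.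 Then $$\lambda^{\mathcal R}_F([\vec x,r])=\langle\!\langle\,i\mapsto F(\psi_i)(\vec x(i)),\ r\,\rangle\!\rangle\in\mathcal R(F(b))\subseteq\coprod_{a\in A}\mathcal R(F(a)).$$ $\lambda^{\mathcal V}$ is defined in the same way. The Płonka sum of a functor $\mathbf F:\mathbf A\to\mathcal{EM}(\mathcal R)$, $\mathbf F(a)=(F(a),\xi_a)$, is the set $\coprod_{a\in A}F(a)$ with structure map $(\coprod_a\xi_a)\circ\lambda^{\mathcal R}_F$; similarly for $\mathcal V$. Preservation. $\mathcal{EM}(\tau)$ preserves Płonka sums if for every suplattice $A$ and every functor $\mathbf F:CP_{\infty r}(A)\to\mathcal{EM}(\mathcal V)$, $\mathbf F(a)=(F(a),\xi_a)$, the Płonka sum of $\mathcal{EM}(\tau)\circ\mathbf F$ and the image under $\mathcal{EM}(\tau)$ of the Płonka sum of $\mathbf F$ carry the same $\mathcal R$-structure on $\coprod_aF(a)$, i.e. $$\Big(\coprod_a\xi_a\Big)\circ\Big(\coprod_a\tau_{F(a)}\Big)\circ\lambda^{\mathcal R}_F=\Big(\coprod_a\xi_a\Big)\circ\lambda^{\mathcal V}_F\circ\tau_{\coprod_aF(a)} .$$ *)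

theory Defs
  imports "HOL-Library.FuncSet" "HOL-Library.Equipollence"
begin

section \<open>The category of sets\<close>

text \<open>
  \<open>Set\<close> is the category of small subsets of a type \<open>'u\<close> that plays the part of a Grothendieck
  universe: the cardinality of \<open>'u\<close> is a regular strong limit (these axioms force \<open>'u\<close> to be
  infinite), and small means of smaller cardinality than \<open>'u\<close>. The type is well-ordered in its
  initial order type, so that its elements also serve as the ordinals of the universe, with
  \<open>bot\<close> as the ordinal 0. For \<open>'u\<close> the set of elements of a Grothendieck universe, i.e. of
  (strongly) inaccessible cardinality, the small sets are the members of the universe. An axiom of
  infinity is not imposed: it is not needed, and without it the type \<open>nat\<close>, with the finite sets as
  small sets, is an instance too.
\<close>

class set_universe = wellorder + order_bot +
  assumes segment_small: "{..<a} \<prec> (UNIV :: 'a set)"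
    and Pow_small: "X \<prec> (UNIV :: 'a set) \<Longrightarrow> Pow X \<prec> (UNIV :: 'a set)"
    and UN_small: "X \<prec> (UNIV :: 'a set) \<Longrightarrow> (\<And>x. x \<in> X \<Longrightarrow> Y x \<prec> (UNIV :: 'a set))
                     \<Longrightarrow> (\<Union>x\<in>X. Y x) \<prec> (UNIV :: 'a set)"

instance nat :: set_universe
proof
  have fin: "X \<prec> (UNIV :: nat set) \<longleftrightarrow> finite X" for X :: "'b set"
    by (metis finite_lesspoll_infinite infinite_UNIV_nat infinite_le_lepoll lepoll_iff_leqpoll
        lesspoll_not_refl lesspoll_trans1)
  show "{..<a} \<prec> (UNIV :: nat set)" for a :: nat by (simp add: fin)
  show "Pow X \<prec> (UNIV :: nat set)" if "X \<prec> (UNIV :: nat set)" for X :: "nat set"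
    using that by (simp add: fin)
  show "(\<Union>x\<in>X. Y x) \<prec> (UNIV :: nat set)"
    if "X \<prec> (UNIV :: nat set)" "\<And>x. x \<in> X \<Longrightarrow> Y x \<prec> (UNIV :: nat set)"
    for X :: "nat set" and Y :: "nat \<Rightarrow> nat set"
    using that by (simp add: fin)
qed

definition small :: "'u::set_universe set \<Rightarrow> bool" where
  "small X \<longleftrightarrow> X \<prec> (UNIV :: 'u set)"

text \<open>The morphisms \<open>X \<rightarrow> Y\<close> of \<open>Set\<close> are the elements of \<open>X \<rightarrow>\<^sub>E Y\<close>, composed by \<^const>\<open>compose\<close>.\<close>

abbreviation idt :: "'u set \<Rightarrow> 'u \<Rightarrow> 'u" where
  "idt X \<equiv> (\<lambda>x\<in>X. x)"

text \<open>Ordered pairs inside the universe, used for set-indexed coproducts.\<close>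

lemma infinite_universe: "infinite (UNIV :: 'u::set_universe set)"
proof
  assume fin: "finite (UNIV :: 'u set)"
  let ?X = "UNIV - {bot :: 'u}"
  have "card ?X < card (UNIV :: 'u set)"
    using fin by (intro psubset_card_mono) auto
  have lp: "X \<prec> (UNIV :: 'u set) \<longleftrightarrow> card X < card (UNIV :: 'u set)" if "finite X" for X :: "'b set"
    using that fin
    by (metis eqpoll_iff_card lepoll_iff_card_le lepoll_iff_leqpoll le_neq_implies_less
        lesspoll_def nat_less_le)
  have "?X \<prec> (UNIV :: 'u set)"
    using lp[of ?X] fin \<open>card ?X < card UNIV\<close> by auto
  then have "Pow ?X \<prec> (UNIV :: 'u set)" by (rule Pow_small)
  then have "card (Pow ?X) < card (UNIV :: 'u set)"
    using lp[of "Pow ?X"] fin by (simp add: finite_subset)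
  moreover have "card (Pow ?X) = 2 ^ card ?X" using fin by (simp add: card_Pow finite_subset)
  moreover have "card ?X < 2 ^ card ?X" by simp
  moreover have "card (UNIV :: 'u set) = Suc (card ?X)"
    using fin by (metis UNIV_I card_Suc_Diff1)
  ultimately show False by linarith
qed

definition upair :: "'u::set_universe \<Rightarrow> 'u \<Rightarrow> 'u" where
  "upair = (SOME p. inj (\<lambda>(a, x). p a x))"

lemma upair_eq_iff [simp]: "upair a x = upair b y \<longleftrightarrow> a = b \<and> x = (y :: 'u::set_universe)"
proof -
  have "(UNIV :: 'u set) \<times> (UNIV :: 'u set) \<approx> (UNIV :: 'u set)"
    using card_of_Times_same_infinite[OF infinite_universe] by (simp add: eqpoll_iff_card_of_ordIso)
  then obtain g :: "'u \<times> 'u \<Rightarrow> 'u" where "bij_betw g (UNIV \<times> UNIV) UNIV"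
    unfolding eqpoll_def by blast
  then have "inj (\<lambda>(a, x). curry g a x)"
    by (simp add: bij_betw_def curry_def)
  then have "inj (\<lambda>(a, x). upair a x :: 'u)"
    unfolding upair_def by (rule someI[where P = "\<lambda>p. inj (\<lambda>(a, x). p a x)"])
  then show ?thesis by (auto dest: injD[of _ "(a, x)" "(b, y)"])
qed

definition ufst :: "'u::set_universe \<Rightarrow> 'u" where
  "ufst z = (THE a. \<exists>x. z = upair a x)"

definition usnd :: "'u::set_universe \<Rightarrow> 'u" where
  "usnd z = (THE x. \<exists>a. z = upair a x)"

lemma ufst_upair [simp]: "ufst (upair a x) = a" and usnd_upair [simp]: "usnd (upair a x) = x"
  by (auto simp: ufst_def usnd_def)

definition coprod :: "'u::set_universe set \<Rightarrow> ('u \<Rightarrow> 'u set) \<Rightarrow> 'u set" where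
  "coprod A X = {upair a x |a x. a \<in> A \<and> x \<in> X a}"

definition coprod_map ::
    "'u::set_universe set \<Rightarrow> ('u \<Rightarrow> 'u set) \<Rightarrow> ('u \<Rightarrow> 'u \<Rightarrow> 'u) \<Rightarrow> 'u \<Rightarrow> 'u" where
  "coprod_map A X h = (\<lambda>z\<in>coprod A X. upair (ufst z) (h (ufst z) (usnd z)))"

definition is_pullback ::
    "'u::set_universe set \<Rightarrow> 'u set \<Rightarrow> 'u set \<Rightarrow> 'u set
      \<Rightarrow> ('u \<Rightarrow> 'u) \<Rightarrow> ('u \<Rightarrow> 'u) \<Rightarrow> ('u \<Rightarrow> 'u) \<Rightarrow> ('u \<Rightarrow> 'u) \<Rightarrow> bool" where
  "is_pullback P X Y Z p q f g \<longleftrightarrow>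
     p \<in> P \<rightarrow>\<^sub>E X \<and> q \<in> P \<rightarrow>\<^sub>E Y \<and> f \<in> X \<rightarrow>\<^sub>E Z \<and> g \<in> Y \<rightarrow>\<^sub>E Z \<and>
     compose P f p = compose P g q \<and>
     (\<forall>(W :: 'u set) h k. small W \<and> h \<in> W \<rightarrow>\<^sub>E X \<and> k \<in> W \<rightarrow>\<^sub>E Y \<and> compose W f h = compose W g k
        \<longrightarrow> (\<exists>!m. m \<in> W \<rightarrow>\<^sub>E P \<and> compose W p m = h \<and> compose W q m = k))"


section \<open>Endofunctors, natural transformations and monads on \<open>Set\<close>\<close>

text \<open>\<open>Ar T X Y f\<close> is the value of the functor at the morphism \<open>f : X \<rightarrow> Y\<close>.\<close>

record 'u endo =
  Ob :: "'u set \<Rightarrow> 'u set"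
  Ar :: "'u set \<Rightarrow> 'u set \<Rightarrow> ('u \<Rightarrow> 'u) \<Rightarrow> 'u \<Rightarrow> 'u"

definition endofunctor :: "('u::set_universe, 'm) endo_scheme \<Rightarrow> bool" where
  "endofunctor T \<longleftrightarrow>
     (\<forall>X. small X \<longrightarrow> small (Ob T X)) \<and>
     (\<forall>X Y. \<forall>f \<in> X \<rightarrow>\<^sub>E Y. small X \<and> small Y \<longrightarrow> Ar T X Y f \<in> Ob T X \<rightarrow>\<^sub>E Ob T Y) \<and>
     (\<forall>X. small X \<longrightarrow> Ar T X X (idt X) = idt (Ob T X)) \<and>
     (\<forall>X Y Z. \<forall>f \<in> X \<rightarrow>\<^sub>E Y. \<forall>g \<in> Y \<rightarrow>\<^sub>E Z. small X \<and> small Y \<and> small Z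
        \<longrightarrow> Ar T X Z (compose X g f) = compose (Ob T X) (Ar T Y Z g) (Ar T X Y f))"

definition id_endo :: "'u endo" where
  "id_endo = \<lparr>Ob = (\<lambda>X. X), Ar = (\<lambda>X Y f. f)\<rparr>"

definition comp_endo :: "('u, 'm) endo_scheme \<Rightarrow> ('u, 'n) endo_scheme \<Rightarrow> 'u endo" where
  "comp_endo S T =
     \<lparr>Ob = (\<lambda>X. Ob S (Ob T X)), Ar = (\<lambda>X Y f. Ar S (Ob T X) (Ob T Y) (Ar T X Y f))\<rparr>"

definition natural ::
    "('u::set_universe, 'm) endo_scheme \<Rightarrow> ('u, 'n) endo_scheme \<Rightarrow> ('u set \<Rightarrow> 'u \<Rightarrow> 'u) \<Rightarrow> bool" where
  "natural S T \<alpha> \<longleftrightarrow>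
     (\<forall>X. small X \<longrightarrow> \<alpha> X \<in> Ob S X \<rightarrow>\<^sub>E Ob T X) \<and>
     (\<forall>X Y. \<forall>f \<in> X \<rightarrow>\<^sub>E Y. small X \<and> small Y
        \<longrightarrow> compose (Ob S X) (\<alpha> Y) (Ar S X Y f) = compose (Ob S X) (Ar T X Y f) (\<alpha> X))"

definition semi_cartesian ::
    "('u::set_universe, 'm) endo_scheme \<Rightarrow> ('u, 'n) endo_scheme \<Rightarrow> ('u set \<Rightarrow> 'u \<Rightarrow> 'u) \<Rightarrow> bool" where
  "semi_cartesian S T \<alpha> \<longleftrightarrow>
     natural S T \<alpha> \<and>
     (\<forall>X Y. \<forall>f \<in> X \<rightarrow>\<^sub>E Y. small X \<and> small Y \<and> inj_on f X
        \<longrightarrow> is_pullback (Ob S X) (Ob S Y) (Ob T X) (Ob T Y) (Ar S X Y f) (\<alpha> X) (\<alpha> Y) (Ar T X Y f))"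

record 'u mnd = "'u endo" +
  Eta :: "'u set \<Rightarrow> 'u \<Rightarrow> 'u"
  Mu :: "'u set \<Rightarrow> 'u \<Rightarrow> 'u"

definition monad :: "('u::set_universe, 'm) mnd_scheme \<Rightarrow> bool" where
  "monad T \<longleftrightarrow>
     endofunctor T \<and> natural id_endo T (Eta T) \<and> natural (comp_endo T T) T (Mu T) \<and>
     (\<forall>X. small X \<longrightarrow>
        compose (Ob T X) (Mu T X) (Eta T (Ob T X)) = idt (Ob T X) \<and>
        compose (Ob T X) (Mu T X) (Ar T X (Ob T X) (Eta T X)) = idt (Ob T X) \<and>
        compose (Ob T (Ob T (Ob T X))) (Mu T X) (Mu T (Ob T X)) =
        compose (Ob T (Ob T (Ob T X))) (Mu T X) (Ar T (Ob T (Ob T X)) (Ob T X) (Mu T X)))"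

definition monad_morphism ::
    "('u::set_universe, 'm) mnd_scheme \<Rightarrow> ('u, 'n) mnd_scheme \<Rightarrow> ('u set \<Rightarrow> 'u \<Rightarrow> 'u) \<Rightarrow> bool" where
  "monad_morphism S T \<tau> \<longleftrightarrow>
     natural S T \<tau> \<and>
     (\<forall>X. small X \<longrightarrow>
        compose X (\<tau> X) (Eta S X) = Eta T X \<and>
        compose (Ob S (Ob S X)) (\<tau> X) (Mu S X) =
        compose (Ob S (Ob S X)) (Mu T X)
          (compose (Ob S (Ob S X)) (\<tau> (Ob T X)) (Ar S (Ob S X) (Ob T X) (\<tau> X))))"


section \<open>Semi-analytic functors\<close>

definition cardinal :: "'u::set_universe \<Rightarrow> bool" where
  "cardinal \<kappa> \<longleftrightarrow> \<not> (\<exists>\<alpha><\<kappa>. {..<\<alpha>} \<approx> {..<\<kappa>})"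

text \<open>\<open>std \<kappa>\<close> is the set of the ordinals \<open>1, \<dots>, \<kappa>\<close>.\<close>

definition std :: "'u::set_universe \<Rightarrow> 'u set" where
  "std \<kappa> = {bot<..\<kappa>}"

definition Surj :: "'u::set_universe \<Rightarrow> 'u \<Rightarrow> ('u \<Rightarrow> 'u) set" where
  "Surj \<kappa> \<kappa>' = {s \<in> std \<kappa> \<rightarrow>\<^sub>E std \<kappa>'. s ` std \<kappa> = std \<kappa>'}"

definition Inj :: "'u::set_universe \<Rightarrow> 'u set \<Rightarrow> ('u \<Rightarrow> 'u) set" where
  "Inj \<kappa> X = {x \<in> std \<kappa> \<rightarrow>\<^sub>E X. inj_on x (std \<kappa>)}"

text \<open>Functors from the category of cardinals and surjections to \<open>Set\<close>.\<close>

record 'u coeff =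
  Co :: "'u \<Rightarrow> 'u set"
  Ca :: "'u \<Rightarrow> 'u \<Rightarrow> ('u \<Rightarrow> 'u) \<Rightarrow> 'u \<Rightarrow> 'u"

definition coeff_functor :: "'u::set_universe coeff \<Rightarrow> bool" where
  "coeff_functor R \<longleftrightarrow>
     (\<forall>\<kappa>. cardinal \<kappa> \<longrightarrow> small (Co R \<kappa>)) \<and>
     (\<forall>\<kappa> \<kappa>'. \<forall>s \<in> Surj \<kappa> \<kappa>'. cardinal \<kappa> \<and> cardinal \<kappa>' \<longrightarrow> Ca R \<kappa> \<kappa>' s \<in> Co R \<kappa> \<rightarrow>\<^sub>E Co R \<kappa>') \<and>
     (\<forall>\<kappa>. cardinal \<kappa> \<longrightarrow> Ca R \<kappa> \<kappa> (idt (std \<kappa>)) = idt (Co R \<kappa>)) \<and>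
     (\<forall>\<kappa> \<kappa>' \<kappa>''. \<forall>s \<in> Surj \<kappa> \<kappa>'. \<forall>s' \<in> Surj \<kappa>' \<kappa>''. cardinal \<kappa> \<and> cardinal \<kappa>' \<and> cardinal \<kappa>''
        \<longrightarrow> Ca R \<kappa> \<kappa>'' (compose (std \<kappa>) s' s) = compose (Co R \<kappa>) (Ca R \<kappa>' \<kappa>'' s') (Ca R \<kappa> \<kappa>' s))"

text \<open>
  The sum over all cardinals \<open>\<kappa>\<close> of the products \<open>Inj \<kappa> X \<times> R \<kappa>\<close>, before the quotient. The relation
  \<open>san_rel\<close> comes from a group action on each summand, hence is already an equivalence relation.
\<close>

definition san_raw :: "'u::set_universe coeff \<Rightarrow> 'u set \<Rightarrow> ('u \<times> ('u \<Rightarrow> 'u) \<times> 'u) set" where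
  "san_raw R X = {(\<kappa>, x, r). cardinal \<kappa> \<and> x \<in> Inj \<kappa> X \<and> r \<in> Co R \<kappa>}"

definition san_rel :: "'u::set_universe coeff \<Rightarrow> 'u set \<Rightarrow> ('u \<times> ('u \<Rightarrow> 'u) \<times> 'u) rel" where
  "san_rel R X =
     {((\<kappa>, compose (std \<kappa>) x \<sigma>, r), (\<kappa>, x, Ca R \<kappa> \<kappa> \<sigma> r)) |\<kappa> x \<sigma> r.
        (\<kappa>, x, r) \<in> san_raw R X \<and> \<sigma> \<in> std \<kappa> \<rightarrow>\<^sub>E std \<kappa> \<and> bij_betw \<sigma> (std \<kappa>) (std \<kappa>)}"

type_synonym 'u san_elem = "('u \<times> ('u \<Rightarrow> 'u) \<times> 'u) set"

definition san_ob :: "'u::set_universe coeff \<Rightarrow> 'u set \<Rightarrow> 'u san_elem set" where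
  "san_ob R X = san_raw R X // san_rel R X"

definition san_class :: "'u::set_universe coeff \<Rightarrow> 'u set \<Rightarrow> 'u \<Rightarrow> ('u \<Rightarrow> 'u) \<Rightarrow> 'u \<Rightarrow> 'u san_elem" where
  "san_class R X \<kappa> x r = san_rel R X `` {(\<kappa>, x, r)}"

definition san_ar ::
    "'u::set_universe coeff \<Rightarrow> 'u set \<Rightarrow> 'u set \<Rightarrow> ('u \<Rightarrow> 'u) \<Rightarrow> 'u san_elem \<Rightarrow> 'u san_elem" where
  "san_ar R X Y f c =
     (THE d. \<exists>\<kappa> x r \<kappa>' s y.
        (\<kappa>, x, r) \<in> san_raw R X \<and> c = san_class R X \<kappa> x r \<and>
        cardinal \<kappa>' \<and> s \<in> Surj \<kappa> \<kappa>' \<and> y \<in> Inj \<kappa>' Y \<and>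
        compose (std \<kappa>) f x = compose (std \<kappa>) y s \<and>
        d = san_class R Y \<kappa>' y (Ca R \<kappa> \<kappa>' s r))"

text \<open>\<open>\<phi>\<close> is a natural isomorphism from the functor given by \<open>R\<close> to \<open>T\<close>.\<close>

definition san_iso ::
    "'u::set_universe coeff \<Rightarrow> ('u, 'm) endo_scheme \<Rightarrow> ('u set \<Rightarrow> 'u san_elem \<Rightarrow> 'u) \<Rightarrow> bool" where
  "san_iso R T \<phi> \<longleftrightarrow>
     (\<forall>X. small X \<longrightarrow> bij_betw (\<phi> X) (san_ob R X) (Ob T X)) \<and>
     (\<forall>X Y. \<forall>f \<in> X \<rightarrow>\<^sub>E Y. \<forall>c \<in> san_ob R X. small X \<and> small Y
        \<longrightarrow> \<phi> Y (san_ar R X Y f c) = Ar T X Y f (\<phi> X c))"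

text \<open>
  A monad in \<open>SANMND\<close>, together with an isomorphism of its functor part with a functor of the above
  form. The definitions below do not depend on the choice of this isomorphism.
\<close>

record 'u san_mnd = "'u mnd" +
  Coef :: "'u coeff"
  Iso :: "'u set \<Rightarrow> 'u san_elem \<Rightarrow> 'u"

definition sanmnd :: "'u::set_universe san_mnd \<Rightarrow> bool" where
  "sanmnd T \<longleftrightarrow>
     monad T \<and> coeff_functor (Coef T) \<and> san_iso (Coef T) T (Iso T) \<and>
     semi_cartesian id_endo T (Eta T) \<and> semi_cartesian (comp_endo T T) T (Mu T)"

text \<open>
  For \<open>r \<in> R \<kappa>\<close>, \<open>elt T X \<kappa> x r\<close> is the element \<open>[x, r]\<close> of \<open>T X\<close>, where \<open>x\<close> is injective, and
  \<open>delt T X \<kappa> x r\<close> is \<open>\<langle>\<langle>x, r\<rangle>\<rangle>\<close>, where \<open>x : std \<kappa> \<rightarrow> X\<close> is arbitrary.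
\<close>

definition elt :: "'u::set_universe san_mnd \<Rightarrow> 'u set \<Rightarrow> 'u \<Rightarrow> ('u \<Rightarrow> 'u) \<Rightarrow> 'u \<Rightarrow> 'u" where
  "elt T X \<kappa> x r = Iso T X (san_class (Coef T) X \<kappa> x r)"

definition delt :: "'u::set_universe san_mnd \<Rightarrow> 'u set \<Rightarrow> 'u \<Rightarrow> ('u \<Rightarrow> 'u) \<Rightarrow> 'u \<Rightarrow> 'u" where
  "delt T X \<kappa> x r = Ar T (std \<kappa>) X x (elt T (std \<kappa>) \<kappa> (idt (std \<kappa>)) r)"


section \<open>Eilenberg-Moore algebras\<close>

definition em_algebra ::
    "('u::set_universe, 'm) mnd_scheme \<Rightarrow> 'u set \<times> ('u \<Rightarrow> 'u) \<Rightarrow> bool" where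
  "em_algebra T = (\<lambda>(B, \<beta>).
     small B \<and> \<beta> \<in> Ob T B \<rightarrow>\<^sub>E B \<and>
     compose B \<beta> (Eta T B) = idt B \<and>
     compose (Ob T (Ob T B)) \<beta> (Mu T B) = compose (Ob T (Ob T B)) \<beta> (Ar T (Ob T B) B \<beta>))"

definition em_hom ::
    "('u::set_universe, 'm) mnd_scheme \<Rightarrow> 'u set \<times> ('u \<Rightarrow> 'u) \<Rightarrow> 'u set \<times> ('u \<Rightarrow> 'u)
      \<Rightarrow> ('u \<Rightarrow> 'u) \<Rightarrow> bool" where
  "em_hom T = (\<lambda>(B, \<beta>) (C, \<gamma>) h.
     h \<in> B \<rightarrow>\<^sub>E C \<and> compose (Ob T B) h \<beta> = compose (Ob T B) \<gamma> (Ar T B C h))"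

text \<open>The object part of the functor induced by \<open>\<tau> : S \<rightarrow> T\<close>; on homomorphisms it is the identity.\<close>

definition em_map ::
    "('u::set_universe, 'm) mnd_scheme \<Rightarrow> ('u set \<Rightarrow> 'u \<Rightarrow> 'u)
      \<Rightarrow> 'u set \<times> ('u \<Rightarrow> 'u) \<Rightarrow> 'u set \<times> ('u \<Rightarrow> 'u)" where
  "em_map S \<tau> = (\<lambda>(B, \<beta>). (B, compose (Ob S B) \<beta> (\<tau> B)))"


section \<open>Suplattices and their categories of infinitary regular polynomials\<close>

definition is_join :: "'u set \<Rightarrow> 'u rel \<Rightarrow> 'u set \<Rightarrow> 'u \<Rightarrow> bool" where
  "is_join A le U v \<longleftrightarrow>
     v \<in> A \<and> (\<forall>u\<in>U. (u, v) \<in> le) \<and> (\<forall>w\<in>A. (\<forall>u\<in>U. (u, w) \<in> le) \<longrightarrow> (v, w) \<in> le)"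

definition Join :: "'u set \<Rightarrow> 'u rel \<Rightarrow> 'u set \<Rightarrow> 'u" where
  "Join A le U = (THE v. is_join A le U v)"

definition suplattice :: "'u::set_universe set \<Rightarrow> 'u rel \<Rightarrow> bool" where
  "suplattice A le \<longleftrightarrow>
     small A \<and> partial_order_on A le \<and> (\<forall>U. U \<subseteq> A \<longrightarrow> (\<exists>v. is_join A le U v))"

definition cp_hom :: "'u set \<Rightarrow> 'u rel \<Rightarrow> 'u \<Rightarrow> 'u \<Rightarrow> ('u set \<times> 'u) set" where
  "cp_hom A le u v = {(U, u') |U u'. u' = u \<and> U \<subseteq> A \<and> u \<in> U \<and> Join A le U = v}"

definition cp_id :: "'u \<Rightarrow> 'u set \<times> 'u" where
  "cp_id u = ({u}, u)"

text \<open>First \<open>(U, u)\<close>, then \<open>(U', v)\<close>.\<close>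

definition cp_comp :: "'u set \<times> 'u \<Rightarrow> 'u set \<times> 'u \<Rightarrow> 'u set \<times> 'u" where
  "cp_comp = (\<lambda>(U, u) (U', v). (U \<union> (U' - {v}), u))"

text \<open>
  The data of a functor from the category of polynomials of a suplattice to a category of algebras:
  \<open>Alg D a\<close> is the algebra at the object \<open>a\<close>, and \<open>Hom D (U, u)\<close> is the value at the morphism
  \<open>(U, u)\<close>, whose domain \<open>u\<close> and codomain \<open>\<Or>U\<close> are determined by it.
\<close>

record 'u diagram =
  Alg :: "'u \<Rightarrow> 'u set \<times> ('u \<Rightarrow> 'u)"
  Hom :: "'u set \<times> 'u \<Rightarrow> 'u \<Rightarrow> 'u"

abbreviation Car :: "'u diagram \<Rightarrow> 'u \<Rightarrow> 'u set" where
  "Car D a \<equiv> fst (Alg D a)"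

abbreviation Str :: "'u diagram \<Rightarrow> 'u \<Rightarrow> 'u \<Rightarrow> 'u" where
  "Str D a \<equiv> snd (Alg D a)"

definition em_functor ::
    "('u::set_universe, 'm) mnd_scheme \<Rightarrow> 'u set \<Rightarrow> 'u rel \<Rightarrow> 'u diagram \<Rightarrow> bool" where
  "em_functor T A le D \<longleftrightarrow>
     (\<forall>a\<in>A. em_algebra T (Alg D a)) \<and>
     (\<forall>u\<in>A. \<forall>v\<in>A. \<forall>m \<in> cp_hom A le u v. em_hom T (Alg D u) (Alg D v) (Hom D m)) \<and>
     (\<forall>u\<in>A. Hom D (cp_id u) = idt (Car D u)) \<and>
     (\<forall>u\<in>A. \<forall>v\<in>A. \<forall>w\<in>A. \<forall>m \<in> cp_hom A le u v. \<forall>m' \<in> cp_hom A le v w.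
        Hom D (cp_comp m m') = compose (Car D u) (Hom D m') (Hom D m))"

definition em_map_diagram ::
    "('u::set_universe, 'm) mnd_scheme \<Rightarrow> ('u set \<Rightarrow> 'u \<Rightarrow> 'u) \<Rightarrow> 'u diagram \<Rightarrow> 'u diagram" where
  "em_map_diagram S \<tau> D = \<lparr>Alg = (\<lambda>a. em_map S \<tau> (Alg D a)), Hom = Hom D\<rparr>"


section \<open>Plonka sums\<close>

text \<open>The map from \<open>T (\<Coprod>a\<in>A. F a)\<close> to \<open>\<Coprod>a\<in>A. T (F a)\<close>.\<close>

definition lam ::
    "'u::set_universe san_mnd \<Rightarrow> 'u set \<Rightarrow> 'u rel \<Rightarrow> 'u diagram \<Rightarrow> 'u \<Rightarrow> 'u" where
  "lam T A le D = (\<lambda>t \<in> Ob T (coprod A (Car D)).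
     THE w. \<exists>\<kappa> x r.
       (\<kappa>, x, r) \<in> san_raw (Coef T) (coprod A (Car D)) \<and>
       t = elt T (coprod A (Car D)) \<kappa> x r \<and>
       (let U = (\<lambda>i. ufst (x i)) ` std \<kappa>; b = Join A le U in
          w = upair b (delt T (Car D b) \<kappa> (\<lambda>i\<in>std \<kappa>. Hom D (U, ufst (x i)) (usnd (x i))) r)))"

definition plonka_sum ::
    "'u::set_universe san_mnd \<Rightarrow> 'u set \<Rightarrow> 'u rel \<Rightarrow> 'u diagram \<Rightarrow> 'u set \<times> ('u \<Rightarrow> 'u)" where
  "plonka_sum T A le D =
     (coprod A (Car D),
      compose (Ob T (coprod A (Car D)))
        (coprod_map A (\<lambda>a. Ob T (Car D a)) (Str D))
        (lam T A le D))"

definition preserves_plonka_sums ::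
    "'u::set_universe san_mnd \<Rightarrow> 'u san_mnd \<Rightarrow> ('u set \<Rightarrow> 'u \<Rightarrow> 'u) \<Rightarrow> bool" where
  "preserves_plonka_sums R V \<tau> \<longleftrightarrow>
     (\<forall>A le D. suplattice A le \<and> em_functor V A le D \<longrightarrow>
        plonka_sum R A le (em_map_diagram R \<tau> D) = em_map R \<tau> (plonka_sum V A le D))"

end

theory Submission
  imports Defs
begin

text \<open>
  The support of \<open>[x, r] \<in> T X\<close>, with \<open>x\<close> injective, is the set of entries of \<open>x\<close>. It does not depend on
  the representative, satisfies \<open>supp (T f t) = f (supp t)\<close>, and for an injection \<open>f : X \<rightarrow> Y\<close> the
  elements in the image of the injective map \<open>T f\<close> are those with support in the image of \<open>f\<close>. The
  theorem holds because both of its sides say that \<open>\<tau>\<close> preserves supports, that is,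
  \<open>supp (\<tau> t) = supp t\<close>. The inclusion of \<open>supp (\<tau> t)\<close> in \<open>supp t\<close> holds for every natural
  transformation.

  For semi-cartesian transformations (\<open>semi_cartesian_iff_supp\<close>) this is immediate from the
  description of the images of the maps \<open>T f\<close>.

  If \<open>\<tau>\<close> preserves supports, then it sends each generic element \<open>[1, r]\<close> to a generic element
  \<open>[1, r']\<close> with the same cardinal (\<open>supp_preserving_on_generic\<close>). Hence it sends \<open>[x, r]\<close> to
  \<open>[x, r']\<close>, and it commutes with the maps \<open>\<lambda>\<close>, which act on \<open>x\<close> and leave the coefficient alone
  (\<open>preserves_plonka_sums_if_supp\<close>).

  If \<open>\<tau>\<close> loses an element \<open>i\<close> of the support of some \<open>t\<close>, then a constant diagram of terminal
  algebras over the two-element chain detects the loss: a Plonka sum takes its value in the summand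
  indexed by the join of the indices that occur in the support (\<open>plonka_sum_index\<close>), and this join
  drops from the top to the bottom if \<open>i\<close> is the only element that is given the top as its index
  (\<open>supp_if_preserves_plonka_sums\<close>).
\<close>

section \<open>Cardinals and small sets\<close>

text \<open>
  For nonzero \<open>\<kappa>\<close>, the segment of all ordinals below \<open>\<kappa>\<close> contains 0 and omits \<open>\<kappa>\<close>, and
  \<^term>\<open>std \<kappa>\<close> does the reverse, so exchanging these two is a bijection for finite and infinite \<open>\<kappa>\<close> alike.
\<close>

lemma eqpoll_std: "std \<kappa> \<approx> {..<\<kappa>}"
proof (cases "\<kappa> = bot")
  case True
  then have "std \<kappa> = {}" "{..<\<kappa>} = {}"
    by (auto simp: std_def)
  then show ?thesis by simp
next
  case False
  have "bij_betw (\<lambda>\<alpha>. if \<alpha> = \<kappa> then bot else \<alpha>) (std \<kappa>) {..<\<kappa>}"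
    by (rule bij_betw_byWitness[where f' = "\<lambda>\<alpha>. if \<alpha> = bot then \<kappa> else \<alpha>"])
      (use False in \<open>auto simp: std_def bot.not_eq_extremum\<close>)
  then show ?thesis unfolding eqpoll_def by blast
qed

lemma small_std: "small (std \<kappa>)"
  unfolding small_def by (rule eq_lesspoll_trans[OF eqpoll_std segment_small])

lemma cardinal_unique:
  assumes "cardinal \<kappa>" "cardinal \<kappa>'" "std \<kappa> \<approx> std \<kappa>'"
  shows "\<kappa> = \<kappa>'"
proof -
  have "{..<\<kappa>} \<approx> {..<\<kappa>'}"
    by (rule eqpoll_trans[OF eqpoll_trans[OF eqpoll_sym[OF eqpoll_std] assms(3)] eqpoll_std])
  then show ?thesis
    using assms(1,2) unfolding cardinal_def by (meson eqpoll_sym linorder_neqE)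
qed

text \<open>
  The order of the universe is a well-order on a set that is larger than \<open>X\<close>, so \<open>X\<close> is equipollent
  to a proper initial segment; the shortest such segment belongs to a cardinal.
\<close>

lemma ex_cardinal:
  includes cardinal_syntax
  fixes X :: "'u::set_universe set"
  assumes "small X"
  obtains \<kappa> :: 'u where "cardinal \<kappa>" "std \<kappa> \<approx> X"
proof -
  let ?r = "{(x, y). x \<le> (y :: 'u)}"
  have wo: "Well_order ?r"
  proof -
    have F: "Field ?r = UNIV" and D: "?r - Id = {(x, y). x < y}"
      by (auto simp: Field_def)
    show ?thesis
      unfolding well_order_on_def linear_order_on_def partial_order_on_def preorder_on_def F D
      by (auto simp: refl_on_def trans_def antisym_def total_on_def wf)
  qed
  have F: "Field ?r = UNIV" by (auto simp: Field_def)
  have "|X| <o |UNIV :: 'u set|"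
    using assms lepoll_antisym[of X UNIV]
    unfolding small_def lesspoll_def card_of_ordLess[symmetric] lepoll_def by blast
  also have "|UNIV :: 'u set| \<le>o ?r"
    using card_of_least[of UNIV ?r] wo F by simp
  finally have "|X| <o ?r" .
  then obtain a where "|X| =o Restr ?r (underS ?r a)"
    using ordLess_iff_ordIso_Restr[OF wo card_of_Well_order] by blast
  then obtain f where "bij_betw f (Field |X| ) (Field (Restr ?r (underS ?r a)))"
    unfolding ordIso_def iso_def by blast
  moreover have "Field (Restr ?r (underS ?r a)) = {..<a}"
    by (auto simp: Field_def underS_def)
  ultimately have "bij_betw f X {..<a}"
    by (simp add: Field_card_of)
  then have "X \<approx> {..<a}"
    unfolding eqpoll_def by blast
  then have "{..<a} \<approx> X"
    by (rule eqpoll_sym)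
  then have ex: "\<exists>a :: 'u. {..<a} \<approx> X" ..
  define \<kappa> where "\<kappa> = (LEAST a :: 'u. {..<a} \<approx> X)"
  have \<kappa>: "{..<\<kappa>} \<approx> X" unfolding \<kappa>_def using ex by (rule LeastI_ex)
  have "\<not> {..<\<alpha>} \<approx> {..<\<kappa>}" if "\<alpha> < \<kappa>" for \<alpha>
    using that not_less_Least[of \<alpha> "\<lambda>a. {..<a} \<approx> X"] eqpoll_trans[OF _ \<kappa>]
    unfolding \<kappa>_def by blast
  then have "cardinal \<kappa>" by (auto simp: cardinal_def)
  moreover have "std \<kappa> \<approx> X" by (rule eqpoll_trans[OF eqpoll_std \<kappa>])
  ultimately show ?thesis by (rule that)
qed

lemma small_subset: "small Y \<Longrightarrow> X \<subseteq> Y \<Longrightarrow> small X"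
  unfolding small_def by (meson lesspoll_trans1 subset_imp_lepoll)

lemma small_image: "small X \<Longrightarrow> small (f ` X)" for f :: "'u::set_universe \<Rightarrow> 'u"
  unfolding small_def by (meson lesspoll_trans1 image_lepoll)

lemma small_finite: "finite X \<Longrightarrow> small X"
  unfolding small_def using infinite_universe finite_lesspoll_infinite by blast

lemma small_coprod:
  assumes "small A" "\<And>a. a \<in> A \<Longrightarrow> small (X a)"
  shows "small (coprod A X)"
proof -
  have "coprod A X = (\<Union>a\<in>A. upair a ` X a)"
    by (auto simp: coprod_def)
  moreover have "small (\<Union>a\<in>A. upair a ` X a)"
    using assms UN_small[of A "\<lambda>a. upair a ` X a"] small_image unfolding small_def by blast
  ultimately show ?thesis by simp
qed

lemma eq_composeI: "f \<in> A \<rightarrow>\<^sub>E B \<Longrightarrow> (\<And>i. i \<in> A \<Longrightarrow> f i = g (h i)) \<Longrightarrow> f = compose A g h"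
  by (rule ext) (auto simp: compose_def dest: PiE_arb)

text \<open>
  The image of \<open>x\<close> is small, hence equipollent to some \<^term>\<open>std \<kappa>'\<close>. This is what makes the functor
  given by a coefficient functor act on maps that are not injective.
\<close>

lemma surj_inj_factorization:
  fixes x :: "'u::set_universe \<Rightarrow> 'u"
  assumes "x \<in> std \<kappa> \<rightarrow>\<^sub>E X"
  obtains \<kappa>' s y where "cardinal \<kappa>'" "s \<in> Surj \<kappa> \<kappa>'" "y \<in> Inj \<kappa>' X" "x = compose (std \<kappa>) y s"
proof -
  obtain \<kappa>' :: 'u where \<kappa>': "cardinal \<kappa>'" "std \<kappa>' \<approx> x ` std \<kappa>"
    using ex_cardinal[OF small_image[OF small_std]] .
  then obtain g where g: "bij_betw g (std \<kappa>') (x ` std \<kappa>)"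
    unfolding eqpoll_def by blast
  define y where "y = restrict g (std \<kappa>')"
  define s where "s = restrict (inv_into (std \<kappa>') g \<circ> x) (std \<kappa>)"
  have "y \<in> Inj \<kappa>' X"
    using g assms by (fastforce simp: Inj_def y_def bij_betw_def inj_on_def)
  moreover have "s ` std \<kappa> = std \<kappa>'"
    using bij_betw_inv_into[OF g] by (simp add: s_def image_image[symmetric] bij_betw_def)
  moreover from this have "s \<in> Surj \<kappa> \<kappa>'"
    by (auto simp: Surj_def s_def)
  moreover have "x = compose (std \<kappa>) y s"
  proof (rule eq_composeI[OF assms])
    show "x i = y (s i)" if "i \<in> std \<kappa>" for i
      using that bij_betw_inv_into_right[OF g, of "x i"] \<open>s ` std \<kappa> = std \<kappa>'\<close>
      by (auto simp: y_def s_def)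
  qed
  ultimately show ?thesis using \<kappa>' that by blast
qed

section \<open>The functor given by a coefficient functor\<close>

abbreviation Perm :: "'u::set_universe \<Rightarrow> ('u \<Rightarrow> 'u) set" where
  "Perm \<kappa> \<equiv> {\<sigma> \<in> std \<kappa> \<rightarrow>\<^sub>E std \<kappa>. bij_betw \<sigma> (std \<kappa>) (std \<kappa>)}"

lemma Perm_Surj: "\<sigma> \<in> Perm \<kappa> \<Longrightarrow> \<sigma> \<in> Surj \<kappa> \<kappa>"
  by (auto simp: Surj_def bij_betw_def)

lemma Inj_compose_Perm: "x \<in> Inj \<kappa> X \<Longrightarrow> \<sigma> \<in> Perm \<kappa> \<Longrightarrow> compose (std \<kappa>) x \<sigma> \<in> Inj \<kappa> X"
  using inj_on_compose[of \<sigma> "std \<kappa>" "std \<kappa>" x] by (auto simp: Inj_def compose_def)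

context
  fixes R :: "'u::set_universe coeff"
  assumes R: "coeff_functor R"
begin

lemma Ca_in: "cardinal \<kappa> \<Longrightarrow> cardinal \<kappa>' \<Longrightarrow> s \<in> Surj \<kappa> \<kappa>' \<Longrightarrow> r \<in> Co R \<kappa> \<Longrightarrow> Ca R \<kappa> \<kappa>' s r \<in> Co R \<kappa>'"
  using R unfolding coeff_functor_def by blast

lemma Ca_id: "cardinal \<kappa> \<Longrightarrow> r \<in> Co R \<kappa> \<Longrightarrow> Ca R \<kappa> \<kappa> (idt (std \<kappa>)) r = r"
  using R unfolding coeff_functor_def by (metis restrict_apply')

lemma Ca_comp:
  assumes "cardinal \<kappa>" "cardinal \<kappa>'" "cardinal \<kappa>''" "s \<in> Surj \<kappa> \<kappa>'" "s' \<in> Surj \<kappa>' \<kappa>''" "r \<in> Co R \<kappa>"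
  shows "Ca R \<kappa> \<kappa>'' (compose (std \<kappa>) s' s) r = Ca R \<kappa>' \<kappa>'' s' (Ca R \<kappa> \<kappa>' s r)"
proof -
  have "Ca R \<kappa> \<kappa>'' (compose (std \<kappa>) s' s) = compose (Co R \<kappa>) (Ca R \<kappa>' \<kappa>'' s') (Ca R \<kappa> \<kappa>' s)"
    using R assms unfolding coeff_functor_def by blast
  then show ?thesis using assms by (simp add: compose_eq)
qed

lemma san_relI:
  assumes "(\<kappa>, x, r) \<in> san_raw R X" "\<sigma> \<in> Perm \<kappa>" 
  shows "((\<kappa>, compose (std \<kappa>) x \<sigma>, r), (\<kappa>, x, Ca R \<kappa> \<kappa> \<sigma> r)) \<in> san_rel R X"
  using assms unfolding san_rel_def by blast

lemma san_relE:
  assumes "(p, q) \<in> san_rel R X"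
  obtains \<kappa> x \<sigma> r where "p = (\<kappa>, compose (std \<kappa>) x \<sigma>, r)" "q = (\<kappa>, x, Ca R \<kappa> \<kappa> \<sigma> r)"
    "cardinal \<kappa>" "x \<in> Inj \<kappa> X" "r \<in> Co R \<kappa>" "\<sigma> \<in> Perm \<kappa>"
  using assms unfolding san_rel_def san_raw_def by blast

text \<open>
  Symmetry and transitivity come from inverses and composites of permutations, transported along the
  functoriality of \<open>R\<close>. The consequence that matters is that equality of classes in
  \<^term>\<open>san_ob R X\<close> comes from a single permutation.
\<close>

lemma equiv_san_rel: "equiv (san_raw R X) (san_rel R X)"
proof (rule equivI)
  show "san_rel R X \<subseteq> san_raw R X \<times> san_raw R X"
  proof (rule subrelI)
    fix p q assume "(p, q) \<in> san_rel R X"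
    then show "(p, q) \<in> san_raw R X \<times> san_raw R X"
      by (rule san_relE) (simp add: san_raw_def Ca_in Inj_compose_Perm Perm_Surj)
  qed
  show "refl_on (san_raw R X) (san_rel R X)"
  proof (rule refl_onI)
    fix p assume p: "p \<in> san_raw R X"
    then obtain \<kappa> x r where [simp]: "p = (\<kappa>, x, r)" and *: "cardinal \<kappa>" "x \<in> Inj \<kappa> X" "r \<in> Co R \<kappa>"
      by (auto simp: san_raw_def)
    have "compose (std \<kappa>) x (idt (std \<kappa>)) = x"
      using * by (intro eq_composeI[symmetric]) (auto simp: Inj_def)
    moreover have "idt (std \<kappa>) \<in> Perm \<kappa>"
      by (auto simp: bij_betw_def inj_on_def)
    ultimately show "(p, p) \<in> san_rel R X"
      using san_relI[of \<kappa> x r X "idt (std \<kappa>)"] p * by (simp add: Ca_id)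
  qed
  show "sym (san_rel R X)"
  proof (rule symI)
    fix p q assume "(p, q) \<in> san_rel R X"
    then show "(q, p) \<in> san_rel R X"
    proof (rule san_relE)
      fix \<kappa> x \<sigma> r
      assume *: "p = (\<kappa>, compose (std \<kappa>) x \<sigma>, r)" "q = (\<kappa>, x, Ca R \<kappa> \<kappa> \<sigma> r)"
        "cardinal \<kappa>" "x \<in> Inj \<kappa> X" "r \<in> Co R \<kappa>" "\<sigma> \<in> Perm \<kappa>"
      define \<rho> where "\<rho> = restrict (inv_into (std \<kappa>) \<sigma>) (std \<kappa>)"
      have b: "bij_betw \<sigma> (std \<kappa>) (std \<kappa>)" using * by auto
      then have "bij_betw \<rho> (std \<kappa>) (std \<kappa>)"
        unfolding \<rho>_def by (simp add: bij_betw_inv_into)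
      then have \<rho>: "\<rho> \<in> Perm \<kappa>"
        by (auto simp: \<rho>_def bij_betw_def)
      have 1: "compose (std \<kappa>) \<rho> \<sigma> = idt (std \<kappa>)" and 2: "compose (std \<kappa>) \<sigma> \<rho> = idt (std \<kappa>)"
        using b bij_betw_inv_into_left[OF b] bij_betw_inv_into_right[OF b]
        by (auto simp: compose_def \<rho>_def bij_betw_def intro!: restrict_ext)
      have "compose (std \<kappa>) (compose (std \<kappa>) x \<sigma>) \<rho> = compose (std \<kappa>) x (compose (std \<kappa>) \<sigma> \<rho>)"
        using \<rho> by (intro ext) (auto simp: compose_def)
      also have "\<dots> = x"
        using * unfolding 2 by (intro eq_composeI[symmetric]) (auto simp: Inj_def)
      finally have 3: "compose (std \<kappa>) (compose (std \<kappa>) x \<sigma>) \<rho> = x" .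
      have 4: "Ca R \<kappa> \<kappa> \<rho> (Ca R \<kappa> \<kappa> \<sigma> r) = r"
        using Ca_comp[of \<kappa> \<kappa> \<kappa> \<sigma> \<rho> r] * \<rho> 1 by (simp add: Perm_Surj Ca_id)
      show "(q, p) \<in> san_rel R X"
        using san_relI[of \<kappa> "compose (std \<kappa>) x \<sigma>" "Ca R \<kappa> \<kappa> \<sigma> r" X \<rho>] \<rho> * 3 4
        by (simp add: san_raw_def Inj_compose_Perm Ca_in Perm_Surj)
    qed
  qed
  show "trans (san_rel R X)"
  proof (rule transI)
    fix p q q' assume "(p, q) \<in> san_rel R X" "(q, q') \<in> san_rel R X"
    from this(1) show "(p, q') \<in> san_rel R X"
    proof (rule san_relE)
      fix \<kappa> x \<sigma> r
      assume *: "p = (\<kappa>, compose (std \<kappa>) x \<sigma>, r)" "q = (\<kappa>, x, Ca R \<kappa> \<kappa> \<sigma> r)"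
        "cardinal \<kappa>" "x \<in> Inj \<kappa> X" "r \<in> Co R \<kappa>" "\<sigma> \<in> Perm \<kappa>"
      from \<open>(q, q') \<in> san_rel R X\<close> show ?thesis
      proof (rule san_relE)
        fix \<kappa>' x' \<sigma>' r'
        assume **: "q = (\<kappa>', compose (std \<kappa>') x' \<sigma>', r')" "q' = (\<kappa>', x', Ca R \<kappa>' \<kappa>' \<sigma>' r')"
          "cardinal \<kappa>'" "x' \<in> Inj \<kappa>' X" "r' \<in> Co R \<kappa>'" "\<sigma>' \<in> Perm \<kappa>'"
        have eqs: "\<kappa>' = \<kappa>" "x = compose (std \<kappa>) x' \<sigma>'" "r' = Ca R \<kappa> \<kappa> \<sigma> r" using * ** by auto
        have "bij_betw (compose (std \<kappa>) \<sigma>' \<sigma>) (std \<kappa>) (std \<kappa>)"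
          using * ** eqs by (intro bij_betw_compose) auto
        then have P: "compose (std \<kappa>) \<sigma>' \<sigma> \<in> Perm \<kappa>"
          by (auto simp: bij_betw_def compose_def)
        have "compose (std \<kappa>) x \<sigma> = compose (std \<kappa>) x' (compose (std \<kappa>) \<sigma>' \<sigma>)"
          using * unfolding eqs(2) by (intro ext) (auto simp: compose_def)
        moreover have "Ca R \<kappa> \<kappa> (compose (std \<kappa>) \<sigma>' \<sigma>) r = Ca R \<kappa> \<kappa> \<sigma>' r'"
          using Ca_comp[of \<kappa> \<kappa> \<kappa> \<sigma> \<sigma>' r] * ** eqs by (simp add: Perm_Surj)
        ultimately show ?thesis
          using san_relI[of \<kappa> x' r X, OF _ P] * ** eqs by (simp add: san_raw_def)
      qed
    qed
  qed
qed

lemma san_class_permute: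
  assumes "(\<kappa>, x, r) \<in> san_raw R X" "\<sigma> \<in> Perm \<kappa>"
  shows "san_class R X \<kappa> (compose (std \<kappa>) x \<sigma>) r = san_class R X \<kappa> x (Ca R \<kappa> \<kappa> \<sigma> r)"
  unfolding san_class_def by (rule equiv_class_eq[OF equiv_san_rel san_relI[OF assms]])

lemma san_class_eqE:
  assumes "san_class R X \<kappa> x r = san_class R X \<kappa>' x' r'"
    "(\<kappa>, x, r) \<in> san_raw R X" "(\<kappa>', x', r') \<in> san_raw R X"
  obtains \<sigma> where "\<kappa>' = \<kappa>" "\<sigma> \<in> Perm \<kappa>" "x = compose (std \<kappa>) x' \<sigma>" "r' = Ca R \<kappa> \<kappa> \<sigma> r"
proof -
  have "((\<kappa>, x, r), (\<kappa>', x', r')) \<in> san_rel R X"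
    using assms eq_equiv_class_iff[OF equiv_san_rel] unfolding san_class_def by metis
  then show ?thesis by (rule san_relE) (use that in auto)
qed

text \<open>
  Two representatives \<open>x = x' \<circ> \<sigma>\<close> and \<open>r' = R(\<sigma>)(r)\<close>, with factorizations \<open>f \<circ> x = y \<circ> s\<close> and
  \<open>f \<circ> x' = y' \<circ> s'\<close>, give injections \<open>y\<close> and \<open>y'\<close> with the same image. Hence they differ by a
  permutation \<open>\<rho>\<close>, and cancelling \<open>y'\<close> gives \<open>\<rho> \<circ> s = s' \<circ> \<sigma>\<close>.
\<close>

lemma san_ar_class:
  assumes raw: "(\<kappa>, x, r) \<in> san_raw R X" and f: "f \<in> X \<rightarrow>\<^sub>E Y"
    and fact: "cardinal \<kappa>'" "s \<in> Surj \<kappa> \<kappa>'" "y \<in> Inj \<kappa>' Y"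
      "compose (std \<kappa>) f x = compose (std \<kappa>) y s"
  shows "san_ar R X Y f (san_class R X \<kappa> x r) = san_class R Y \<kappa>' y (Ca R \<kappa> \<kappa>' s r)"
  unfolding san_ar_def
proof (rule the_equality, goal_cases)
  case 1
  show ?case using raw fact by blast
next
  case (2 d)
  then obtain \<kappa>1 x' r' \<kappa>'' s' y' where
    raw': "(\<kappa>1, x', r') \<in> san_raw R X" and cl: "san_class R X \<kappa> x r = san_class R X \<kappa>1 x' r'"
    and fact1: "cardinal \<kappa>''" "s' \<in> Surj \<kappa>1 \<kappa>''" "y' \<in> Inj \<kappa>'' Y"
      "compose (std \<kappa>1) f x' = compose (std \<kappa>1) y' s'"
    and d: "d = san_class R Y \<kappa>'' y' (Ca R \<kappa>1 \<kappa>'' s' r')" by blast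
  from cl raw raw' obtain \<sigma> where k1: "\<kappa>1 = \<kappa>" and \<sigma>: "\<sigma> \<in> Perm \<kappa>"
    and x: "x = compose (std \<kappa>) x' \<sigma>" and r': "r' = Ca R \<kappa> \<kappa> \<sigma> r"
    by (rule san_class_eqE)
  note fact' = fact1[unfolded k1]
  have c: "cardinal \<kappa>" "r \<in> Co R \<kappa>" using raw by (auto simp: san_raw_def)
  have e: "f (x i) = y (s i)" "f (x' i) = y' (s' i)" if "i \<in> std \<kappa>" for i
    using fun_cong[OF fact(4), of i] fun_cong[OF fact'(4), of i] that by (auto simp: compose_eq)
  have e2: "y (s i) = y' (s' (\<sigma> i))" if "i \<in> std \<kappa>" for i
    using e(1)[OF that] e(2)[of "\<sigma> i"] that \<sigma> by (auto simp: x compose_eq)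
  have \<sigma>im: "\<sigma> ` std \<kappa> = std \<kappa>" using \<sigma> by (auto simp: bij_betw_def)
  have sim: "s ` std \<kappa> = std \<kappa>'" "s' ` std \<kappa> = std \<kappa>''"
    using fact(2) fact'(2) by (auto simp: Surj_def)
  have "y ` std \<kappa>' = (\<lambda>i. y (s i)) ` std \<kappa>" by (simp add: sim(1)[symmetric] image_comp comp_def)
  also have "\<dots> = (\<lambda>i. y' (s' (\<sigma> i))) ` std \<kappa>" using e2 by (intro image_cong) auto
  also have "\<dots> = y' ` s' ` \<sigma> ` std \<kappa>" by auto
  also have "\<dots> = y' ` std \<kappa>''" by (simp add: \<sigma>im sim)
  finally have im: "y ` std \<kappa>' = y' ` std \<kappa>''" .
  have inj: "inj_on y (std \<kappa>')" "inj_on y' (std \<kappa>'')"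
    using fact(3) fact'(3) by (auto simp: Inj_def)
  have "std \<kappa>' \<approx> std \<kappa>''"
    using eqpoll_trans[OF eqpoll_sym[OF inj_on_image_eqpoll_self[OF inj(1)]]]
      inj_on_image_eqpoll_self[OF inj(2)] unfolding im by blast
  then have k2: "\<kappa>'' = \<kappa>'" using cardinal_unique[OF fact(1) fact'(1)] by simp
  define \<rho> where "\<rho> = restrict (inv_into (std \<kappa>') y' \<circ> y) (std \<kappa>')"
  have by': "bij_betw y' (std \<kappa>') (y ` std \<kappa>')" and "bij_betw y (std \<kappa>') (y ` std \<kappa>')"
    using inj im k2 by (auto simp: bij_betw_def)
  then have "bij_betw \<rho> (std \<kappa>') (std \<kappa>')"
    unfolding \<rho>_def by (simp add: bij_betw_inv_into bij_betw_trans)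
  then have \<rho>: "\<rho> \<in> Perm \<kappa>'" by (auto simp: \<rho>_def bij_betw_def)
  have y'\<rho>: "y' (\<rho> j) = y j" if "j \<in> std \<kappa>'" for j
    using bij_betw_inv_into_right[OF by'] that by (simp add: \<rho>_def)
  have y: "y = compose (std \<kappa>') y' \<rho>"
    using fact(3) y'\<rho> by (intro eq_composeI) (auto simp: Inj_def)
  have com: "compose (std \<kappa>) \<rho> s = compose (std \<kappa>) s' \<sigma>"
  proof (intro ext)
    fix i
    have "\<rho> (s i) = s' (\<sigma> i)" if "i \<in> std \<kappa>"
    proof (rule inj_onD[OF inj(2)])
      have si: "s i \<in> std \<kappa>'" using that sim by blast
      then show "y' (\<rho> (s i)) = y' (s' (\<sigma> i))" using y'\<rho> e2 that by simp
      show "\<rho> (s i) \<in> std \<kappa>''" using \<rho> si k2 by auto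
      show "s' (\<sigma> i) \<in> std \<kappa>''" using that \<sigma>im sim by blast
    qed
    then show "compose (std \<kappa>) \<rho> s i = compose (std \<kappa>) s' \<sigma> i" by (auto simp: compose_def)
  qed
  have "san_class R Y \<kappa>' y (Ca R \<kappa> \<kappa>' s r) = san_class R Y \<kappa>' y' (Ca R \<kappa>' \<kappa>' \<rho> (Ca R \<kappa> \<kappa>' s r))"
    unfolding y using fact' c fact(2) k2 \<rho> by (intro san_class_permute) (auto simp: san_raw_def Ca_in)
  also have "Ca R \<kappa>' \<kappa>' \<rho> (Ca R \<kappa> \<kappa>' s r) = Ca R \<kappa> \<kappa>' s' (Ca R \<kappa> \<kappa> \<sigma> r)"
    using Ca_comp[of \<kappa> \<kappa>' \<kappa>' s \<rho> r] Ca_comp[of \<kappa> \<kappa> \<kappa>' \<sigma> s' r] com c fact fact' k2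
      Perm_Surj[OF \<rho>] Perm_Surj[OF \<sigma>]
    by simp
  finally show ?case using d k1 k2 r' by simp
qed

end

section \<open>Semi-analytic functors\<close>

locale semi_analytic =
  fixes T :: "'u::set_universe san_mnd"
  assumes endo: "endofunctor T" and coeff: "coeff_functor (Coef T)" and iso: "san_iso (Coef T) T (Iso T)"
begin

lemma Ar_mor: "small X \<Longrightarrow> small Y \<Longrightarrow> f \<in> X \<rightarrow>\<^sub>E Y \<Longrightarrow> Ar T X Y f \<in> Ob T X \<rightarrow>\<^sub>E Ob T Y"
  using endo unfolding endofunctor_def by blast

lemma Ar_in: "small X \<Longrightarrow> small Y \<Longrightarrow> f \<in> X \<rightarrow>\<^sub>E Y \<Longrightarrow> t \<in> Ob T X \<Longrightarrow> Ar T X Y f t \<in> Ob T Y"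
  using Ar_mor by blast

lemma Ar_compose:
  assumes "small X" "small Y" "small Z" "f \<in> X \<rightarrow>\<^sub>E Y" "g \<in> Y \<rightarrow>\<^sub>E Z" "t \<in> Ob T X"
  shows "Ar T X Z (compose X g f) t = Ar T Y Z g (Ar T X Y f t)"
proof -
  have "Ar T X Z (compose X g f) = compose (Ob T X) (Ar T Y Z g) (Ar T X Y f)"
    using endo assms unfolding endofunctor_def by blast
  then show ?thesis using assms by (simp add: compose_eq)
qed

lemma san_class_in_ob: "(\<kappa>, x, r) \<in> san_raw (Coef T) X \<Longrightarrow> san_class (Coef T) X \<kappa> x r \<in> san_ob (Coef T) X"
  unfolding san_class_def san_ob_def by (rule quotientI)

lemma Iso_bij: "small X \<Longrightarrow> bij_betw (Iso T X) (san_ob (Coef T) X) (Ob T X)"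
  using iso unfolding san_iso_def by blast

lemma elt_in: "small X \<Longrightarrow> (\<kappa>, x, r) \<in> san_raw (Coef T) X \<Longrightarrow> elt T X \<kappa> x r \<in> Ob T X"
  unfolding elt_def by (meson Iso_bij bij_betwE san_class_in_ob)

lemma Ob_cases:
  assumes "small X" "t \<in> Ob T X"
  obtains \<kappa> x r where "(\<kappa>, x, r) \<in> san_raw (Coef T) X" "t = elt T X \<kappa> x r"
proof -
  obtain c where "c \<in> san_ob (Coef T) X" "t = Iso T X c"
    using Iso_bij[OF assms(1)] assms(2) by (auto simp: bij_betw_def)
  moreover from this(1) obtain p where "p \<in> san_raw (Coef T) X" "c = san_rel (Coef T) X `` {p}"
    unfolding san_ob_def by (rule quotientE)
  ultimately show ?thesis
    using that by (cases p) (auto simp: elt_def san_class_def)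
qed

lemma elt_permute:
  "(\<kappa>, x, r) \<in> san_raw (Coef T) X \<Longrightarrow> \<sigma> \<in> Perm \<kappa> \<Longrightarrow>
    elt T X \<kappa> (compose (std \<kappa>) x \<sigma>) r = elt T X \<kappa> x (Ca (Coef T) \<kappa> \<kappa> \<sigma> r)"
  unfolding elt_def by (simp add: san_class_permute[OF coeff])

lemma elt_eqE:
  assumes "small X" "elt T X \<kappa> x r = elt T X \<kappa>' x' r'"
    "(\<kappa>, x, r) \<in> san_raw (Coef T) X" "(\<kappa>', x', r') \<in> san_raw (Coef T) X"
  obtains \<sigma> where "\<kappa>' = \<kappa>" "\<sigma> \<in> Perm \<kappa>" "x = compose (std \<kappa>) x' \<sigma>" "r' = Ca (Coef T) \<kappa> \<kappa> \<sigma> r"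
proof -
  have "san_class (Coef T) X \<kappa> x r = san_class (Coef T) X \<kappa>' x' r'"
    by (rule inj_onD[OF bij_betw_imp_inj_on[OF Iso_bij[OF assms(1)]] assms(2)[unfolded elt_def]])
      (rule san_class_in_ob, fact)+
  then show ?thesis by (rule san_class_eqE[OF coeff _ assms(3,4)]) (rule that)
qed

lemma Ar_elt:
  assumes "small X" "small Y" "(\<kappa>, x, r) \<in> san_raw (Coef T) X" "f \<in> X \<rightarrow>\<^sub>E Y"
    "cardinal \<kappa>'" "s \<in> Surj \<kappa> \<kappa>'" "y \<in> Inj \<kappa>' Y" "compose (std \<kappa>) f x = compose (std \<kappa>) y s"
  shows "Ar T X Y f (elt T X \<kappa> x r) = elt T Y \<kappa>' y (Ca (Coef T) \<kappa> \<kappa>' s r)"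
proof -
  have "Ar T X Y f (elt T X \<kappa> x r) = Iso T Y (san_ar (Coef T) X Y f (san_class (Coef T) X \<kappa> x r))"
    using iso assms san_class_in_ob unfolding san_iso_def elt_def by metis
  then show ?thesis
    by (simp add: san_ar_class[OF coeff assms(3-)] elt_def)
qed

text \<open>
  On maps that are injective on the entries of \<open>x\<close>, no identification of entries takes place, so the
  surjection in the factorization is the identity.
\<close>

lemma Ar_elt_inj:
  assumes "small X" "small Y" "(\<kappa>, x, r) \<in> san_raw (Coef T) X" "f \<in> X \<rightarrow>\<^sub>E Y" "inj_on f (x ` std \<kappa>)"
  shows "(\<kappa>, compose (std \<kappa>) f x, r) \<in> san_raw (Coef T) Y"
    and "Ar T X Y f (elt T X \<kappa> x r) = elt T Y \<kappa> (compose (std \<kappa>) f x) r"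
proof -
  have *: "cardinal \<kappa>" "x \<in> std \<kappa> \<rightarrow>\<^sub>E X" "inj_on x (std \<kappa>)" "r \<in> Co (Coef T) \<kappa>"
    using assms(3) by (auto simp: san_raw_def Inj_def)
  have "inj_on (compose (std \<kappa>) f x) (std \<kappa>)"
    using * assms(5) by (auto simp: inj_on_def compose_eq)
  moreover have "compose (std \<kappa>) f x \<in> std \<kappa> \<rightarrow>\<^sub>E Y"
    using * assms(4) by (auto simp: compose_def)
  ultimately have y: "compose (std \<kappa>) f x \<in> Inj \<kappa> Y" by (simp add: Inj_def)
  then show "(\<kappa>, compose (std \<kappa>) f x, r) \<in> san_raw (Coef T) Y"
    using * by (simp add: san_raw_def)
  have "compose (std \<kappa>) f x = compose (std \<kappa>) (compose (std \<kappa>) f x) (idt (std \<kappa>))"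
    by (auto simp: compose_def)
  moreover have "idt (std \<kappa>) \<in> Surj \<kappa> \<kappa>" by (auto simp: Surj_def)
  ultimately show "Ar T X Y f (elt T X \<kappa> x r) = elt T Y \<kappa> (compose (std \<kappa>) f x) r"
    using Ar_elt[OF assms(1-4) *(1) _ y] Ca_id[OF coeff *(1,4)] by metis
qed

lemma raw_generic: "cardinal \<kappa> \<Longrightarrow> r \<in> Co (Coef T) \<kappa> \<Longrightarrow> (\<kappa>, idt (std \<kappa>), r) \<in> san_raw (Coef T) (std \<kappa>)"
  by (auto simp: san_raw_def Inj_def inj_on_def)

lemma delt_in:
  "small X \<Longrightarrow> x \<in> std \<kappa> \<rightarrow>\<^sub>E X \<Longrightarrow> cardinal \<kappa> \<Longrightarrow> r \<in> Co (Coef T) \<kappa> \<Longrightarrow> delt T X \<kappa> x r \<in> Ob T X"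
  unfolding delt_def by (intro Ar_in elt_in raw_generic small_std)

lemma delt_eq_elt:
  assumes "small X" "(\<kappa>, x, r) \<in> san_raw (Coef T) X"
  shows "delt T X \<kappa> x r = elt T X \<kappa> x r"
proof -
  have *: "cardinal \<kappa>" "x \<in> std \<kappa> \<rightarrow>\<^sub>E X" "inj_on x (std \<kappa>)" "r \<in> Co (Coef T) \<kappa>"
    using assms(2) by (auto simp: san_raw_def Inj_def)
  have "compose (std \<kappa>) x (idt (std \<kappa>)) = x"
    by (rule eq_composeI[OF *(2), symmetric]) simp
  then show ?thesis
    using Ar_elt_inj(2)[OF small_std assms(1) raw_generic[OF *(1,4)] *(2)] *(3)
    by (simp add: delt_def)
qed

text \<open>
  Both sides are images under \<open>g\<close> of elements of \<open>T (std \<kappa>)\<close>, and there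
  \<open>[\<sigma>, r] = [1, R(\<sigma>)(r)]\<close>, with \<open>R\<close> the coefficient functor of \<open>T\<close>.
\<close>

lemma delt_permute:
  assumes "small X" "cardinal \<kappa>" "r \<in> Co (Coef T) \<kappa>" "g \<in> std \<kappa> \<rightarrow>\<^sub>E X" "\<sigma> \<in> Perm \<kappa>"
  shows "delt T X \<kappa> (compose (std \<kappa>) g \<sigma>) r = delt T X \<kappa> g (Ca (Coef T) \<kappa> \<kappa> \<sigma> r)"
proof -
  note raw = raw_generic[OF assms(2,3)]
  have \<sigma>: "\<sigma> \<in> std \<kappa> \<rightarrow>\<^sub>E std \<kappa>" "inj_on \<sigma> (std \<kappa>)" using assms(5) by (auto simp: bij_betw_def)
  have "compose (std \<kappa>) \<sigma> (idt (std \<kappa>)) = compose (std \<kappa>) (idt (std \<kappa>)) \<sigma>"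
    using \<sigma> by (intro ext) (auto simp: compose_def)
  then have "Ar T (std \<kappa>) (std \<kappa>) \<sigma> (elt T (std \<kappa>) \<kappa> (idt (std \<kappa>)) r)
      = elt T (std \<kappa>) \<kappa> (idt (std \<kappa>)) (Ca (Coef T) \<kappa> \<kappa> \<sigma> r)"
    using Ar_elt_inj(2)[OF small_std small_std raw \<sigma>(1)] \<sigma>(2) elt_permute[OF raw assms(5)] by simp
  then show ?thesis
    using Ar_compose[OF small_std small_std assms(1) \<sigma>(1) assms(4) elt_in[OF small_std raw]]
    by (simp add: delt_def)
qed

end

section \<open>Supports\<close>

text \<open>All representatives of \<open>t\<close> have the same entries; the union avoids the choice of one.\<close>

definition supp :: "'u::set_universe san_mnd \<Rightarrow> 'u set \<Rightarrow> 'u \<Rightarrow> 'u set" where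
  "supp T X t = \<Union>{x ` std \<kappa> |\<kappa> x r. (\<kappa>, x, r) \<in> san_raw (Coef T) X \<and> t = elt T X \<kappa> x r}"

context semi_analytic
begin

lemma supp_elt:
  assumes "small X" and raw: "(\<kappa>, x, r) \<in> san_raw (Coef T) X"
  shows "supp T X (elt T X \<kappa> x r) = x ` std \<kappa>"
proof -
  have "x' ` std \<kappa>' = x ` std \<kappa>"
    if raw': "(\<kappa>', x', r') \<in> san_raw (Coef T) X" and eq: "elt T X \<kappa> x r = elt T X \<kappa>' x' r'"
    for \<kappa>' x' r'
  proof -
    obtain \<sigma> where \<sigma>: "\<kappa>' = \<kappa>" "\<sigma> \<in> Perm \<kappa>" "x = compose (std \<kappa>) x' \<sigma>"
      "r' = Ca (Coef T) \<kappa> \<kappa> \<sigma> r"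
      using elt_eqE[OF assms(1) eq raw raw'] .
    have "\<sigma> ` std \<kappa> = std \<kappa>" using \<sigma>(2) by (auto simp: bij_betw_def)
    then have "x ` std \<kappa> = x' ` std \<kappa>"
      unfolding \<sigma>(3) by (simp add: compose_eq cong: image_cong flip: image_image)
    then show ?thesis using \<sigma>(1) by simp
  qed
  then show ?thesis
    using raw unfolding supp_def by blast
qed

lemma supp_subset:
  assumes "small X" "t \<in> Ob T X"
  shows "supp T X t \<subseteq> X"
  using assms
proof (rule Ob_cases)
  fix \<kappa> x r assume raw: "(\<kappa>, x, r) \<in> san_raw (Coef T) X" and "t = elt T X \<kappa> x r"
  then have "supp T X t = x ` std \<kappa>" using supp_elt[OF assms(1)] by simp
  then show ?thesis using raw by (auto simp: san_raw_def Inj_def)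
qed

text \<open>
  If \<open>f \<circ> x = y \<circ> s\<close> with \<open>s\<close> surjective, then \<open>f \<circ> x\<close> and \<open>y\<close> have the same image.
\<close>

lemma supp_Ar:
  assumes "small X" "small Y" "f \<in> X \<rightarrow>\<^sub>E Y" "t \<in> Ob T X"
  shows "supp T Y (Ar T X Y f t) = f ` supp T X t"
proof -
  obtain \<kappa> x r where raw: "(\<kappa>, x, r) \<in> san_raw (Coef T) X" and t: "t = elt T X \<kappa> x r"
    using Ob_cases[OF assms(1,4)] .
  then have c: "cardinal \<kappa>" "x \<in> std \<kappa> \<rightarrow>\<^sub>E X" "r \<in> Co (Coef T) \<kappa>" by (auto simp: san_raw_def Inj_def)
  have "compose (std \<kappa>) f x \<in> std \<kappa> \<rightarrow>\<^sub>E Y"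
    using c assms(3) by (auto simp: compose_def)
  then obtain \<kappa>' s y where *: "cardinal \<kappa>'" "s \<in> Surj \<kappa> \<kappa>'" "y \<in> Inj \<kappa>' Y"
      "compose (std \<kappa>) f x = compose (std \<kappa>) y s"
    by (rule surj_inj_factorization)
  have raw': "(\<kappa>', y, Ca (Coef T) \<kappa> \<kappa>' s r) \<in> san_raw (Coef T) Y"
    using * c by (simp add: san_raw_def Ca_in[OF coeff])
  have "f (x i) = y (s i)" if "i \<in> std \<kappa>" for i
    using fun_cong[OF *(4), of i] that by (simp add: compose_eq)
  then have "f ` x ` std \<kappa> = y ` s ` std \<kappa>"
    by (simp add: image_image)
  also have "s ` std \<kappa> = std \<kappa>'" using *(2) by (simp add: Surj_def)
  finally have "f ` supp T X t = y ` std \<kappa>'"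
    using t raw assms by (simp add: supp_elt)
  then show ?thesis
    using Ar_elt[OF assms(1,2) raw assms(3) *] supp_elt[OF assms(2) raw'] t by simp
qed

text \<open>
  A permutation relating \<open>f \<circ> x\<close> and \<open>f \<circ> x'\<close> also relates \<open>x\<close> and \<open>x'\<close>, by cancelling \<open>f\<close>.
\<close>

lemma inj_Ar:
  assumes "small X" "small Y" "f \<in> X \<rightarrow>\<^sub>E Y" "inj_on f X"
  shows "inj_on (Ar T X Y f) (Ob T X)"
proof (rule inj_onI)
  fix t t' assume tt: "t \<in> Ob T X" "t' \<in> Ob T X" and eq: "Ar T X Y f t = Ar T X Y f t'"
  obtain \<kappa> x r where raw: "(\<kappa>, x, r) \<in> san_raw (Coef T) X" and t: "t = elt T X \<kappa> x r"
    using Ob_cases[OF assms(1) tt(1)] .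
  obtain \<kappa>' x' r' where raw': "(\<kappa>', x', r') \<in> san_raw (Coef T) X" and t': "t' = elt T X \<kappa>' x' r'"
    using Ob_cases[OF assms(1) tt(2)] .
  have x: "x \<in> std \<kappa> \<rightarrow>\<^sub>E X" and x': "x' \<in> std \<kappa>' \<rightarrow>\<^sub>E X"
    using raw raw' by (auto simp: san_raw_def Inj_def)
  have i: "inj_on f (x ` std \<kappa>)" "inj_on f (x' ` std \<kappa>')"
    using assms(4) x x' by (auto intro: inj_on_subset)
  note f = Ar_elt_inj[OF assms(1,2) raw assms(3) i(1)]
  note f' = Ar_elt_inj[OF assms(1,2) raw' assms(3) i(2)]
  obtain \<sigma> where \<sigma>: "\<kappa>' = \<kappa>" "\<sigma> \<in> Perm \<kappa>" "r' = Ca (Coef T) \<kappa> \<kappa> \<sigma> r"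
     "compose (std \<kappa>) f x = compose (std \<kappa>) (compose (std \<kappa>') f x') \<sigma>"
    using elt_eqE[OF assms(2) eq[unfolded t t' f(2) f'(2)] f(1) f'(1)] by blast
  have "x = compose (std \<kappa>) x' \<sigma>"
  proof (rule eq_composeI[OF x])
    fix j assume j: "j \<in> std \<kappa>"
    have sj: "\<sigma> j \<in> std \<kappa>" using \<sigma>(2) j by auto
    have "f (x j) = f (x' (\<sigma> j))"
      using fun_cong[OF \<sigma>(4), of j] j sj \<sigma>(1) by (simp add: compose_eq)
    then show "x j = x' (\<sigma> j)"
      using assms(4) x x' j sj \<sigma>(1) by (auto dest!: inj_onD)
  qed
  then show "t = t'"
    using t t' \<sigma> elt_permute[of \<kappa> x' r X \<sigma>] raw raw' by (auto simp: san_raw_def)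
qed

text \<open>
  A representative \<open>[y, r]\<close> of \<open>t\<close> has its entries in the image of \<open>f\<close>, so \<open>y\<close> lifts along \<open>f\<close>. With
  \<open>supp_Ar\<close> this characterizes the image of \<open>T f\<close>, for injective \<open>f\<close>, by supports.
\<close>

lemma supp_in_image:
  assumes "small X" "small Y" "f \<in> X \<rightarrow>\<^sub>E Y" "inj_on f X" "t \<in> Ob T Y" "supp T Y t \<subseteq> f ` X"
  obtains c where "c \<in> Ob T X" "Ar T X Y f c = t"
proof -
  obtain \<kappa> y r where raw: "(\<kappa>, y, r) \<in> san_raw (Coef T) Y" and t: "t = elt T Y \<kappa> y r"
    using Ob_cases[OF assms(2,5)] .
  then have c: "cardinal \<kappa>" "y \<in> std \<kappa> \<rightarrow>\<^sub>E Y" "inj_on y (std \<kappa>)" "r \<in> Co (Coef T) \<kappa>"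
    by (auto simp: san_raw_def Inj_def)
  have im: "y i \<in> f ` X" if "i \<in> std \<kappa>" for i
    using assms(6) supp_elt[OF assms(2) raw] t that by auto
  define x where "x = restrict (inv_into X f \<circ> y) (std \<kappa>)"
  have x: "x i \<in> X" "f (x i) = y i" if "i \<in> std \<kappa>" for i
    using im[OF that] that by (auto simp: x_def inv_into_into f_inv_into_f)
  have "x \<in> std \<kappa> \<rightarrow>\<^sub>E X" using x(1) by (auto simp: x_def)
  moreover have "inj_on x (std \<kappa>)"
    using x(2) c(3) by (metis inj_on_def)
  ultimately have rawx: "(\<kappa>, x, r) \<in> san_raw (Coef T) X"
    using c by (simp add: san_raw_def Inj_def)
  have "y = compose (std \<kappa>) f x"
    by (rule eq_composeI[OF c(2)]) (simp add: x(2))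
  moreover have "inj_on f (x ` std \<kappa>)"
    using assms(4) x(1) by (auto intro: inj_on_subset)
  ultimately have "Ar T X Y f (elt T X \<kappa> x r) = t"
    using Ar_elt_inj(2)[OF assms(1,2) rawx assms(3)] t by simp
  then show ?thesis using that elt_in[OF assms(1) rawx] by blast
qed

end

section \<open>Semi-cartesian transformations and supports\<close>

lemma natural_in: "natural S T \<alpha> \<Longrightarrow> small X \<Longrightarrow> t \<in> Ob S X \<Longrightarrow> \<alpha> X t \<in> Ob T X"
  unfolding natural_def by blast

lemma naturalD:
  assumes "natural S T \<alpha>" "small X" "small Y" "f \<in> X \<rightarrow>\<^sub>E Y" "t \<in> Ob S X"
  shows "\<alpha> Y (Ar S X Y f t) = Ar T X Y f (\<alpha> X t)"
proof -
  have "compose (Ob S X) (\<alpha> Y) (Ar S X Y f) = compose (Ob S X) (Ar T X Y f) (\<alpha> X)"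
    using assms unfolding natural_def by blast
  from fun_cong[OF this, of t] show ?thesis using assms(5) by (simp add: compose_eq)
qed

lemma is_pullbackD:
  fixes W P :: "'u::set_universe set"
  assumes "is_pullback P X Y Z p q f g"
    and W: "small W" "h \<in> W \<rightarrow>\<^sub>E X" "k \<in> W \<rightarrow>\<^sub>E Y" "compose W f h = compose W g k"
  shows "\<exists>!m. m \<in> W \<rightarrow>\<^sub>E P \<and> compose W p m = h \<and> compose W q m = k"
proof -
  have "\<forall>(W :: 'u set) h k. small W \<and> h \<in> W \<rightarrow>\<^sub>E X \<and> k \<in> W \<rightarrow>\<^sub>E Y \<and> compose W f h = compose W g k
      \<longrightarrow> (\<exists>!m. m \<in> W \<rightarrow>\<^sub>E P \<and> compose W p m = h \<and> compose W q m = k)"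
    using assms(1) unfolding is_pullback_def by (elim conjE)
  from this[rule_format, OF conjI[OF W(1) conjI[OF W(2) conjI[OF W(3,4)]]]] show ?thesis .
qed

text \<open>
  The universal property applied to a one-point set.
\<close>

lemma is_pullback_ex:
  fixes P :: "'u::set_universe set"
  assumes "is_pullback P X Y Z p q f g" "x \<in> X" "y \<in> Y" "f x = g y"
  obtains t where "t \<in> P" "p t = x" "q t = y"
proof -
  let ?W = "{bot :: 'u}"
  let ?h = "\<lambda>w\<in>?W. x" and ?k = "\<lambda>w\<in>?W. y"
  have "\<exists>!m. m \<in> ?W \<rightarrow>\<^sub>E P \<and> compose ?W p m = ?h \<and> compose ?W q m = ?k"
    by (rule is_pullbackD[OF assms(1)]) (use assms(2-) in \<open>auto simp: small_finite compose_def\<close>)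
  then obtain m where m: "m \<in> ?W \<rightarrow>\<^sub>E P" "compose ?W p m = ?h" "compose ?W q m = ?k"
    by (elim ex1E conjE)
  show ?thesis
    using that[of "m bot"] m(1) fun_cong[OF m(2), of bot] fun_cong[OF m(3), of bot]
    by (auto simp: compose_eq)
qed

lemma is_pullbackI:
  assumes mor: "p \<in> P \<rightarrow>\<^sub>E X" "q \<in> P \<rightarrow>\<^sub>E Y" "f \<in> X \<rightarrow>\<^sub>E Z" "g \<in> Y \<rightarrow>\<^sub>E Z"
    and com: "compose P f p = compose P g q"
    and inj: "inj_on p P"
    and ex: "\<And>x y. x \<in> X \<Longrightarrow> y \<in> Y \<Longrightarrow> f x = g y \<Longrightarrow> \<exists>t\<in>P. p t = x \<and> q t = y"
  shows "is_pullback P X Y Z p q f g"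
  unfolding is_pullback_def
proof (intro conjI allI impI mor com)
  fix W h k
  assume "small W \<and> h \<in> W \<rightarrow>\<^sub>E X \<and> k \<in> W \<rightarrow>\<^sub>E Y \<and> compose W f h = compose W g k"
  then have h: "h \<in> W \<rightarrow>\<^sub>E X" and k: "k \<in> W \<rightarrow>\<^sub>E Y" and eq: "compose W f h = compose W g k" by auto
  have "\<exists>t\<in>P. p t = h w \<and> q t = k w" if "w \<in> W" for w
    using fun_cong[OF eq, of w] ex[of "h w" "k w"] h k that by (auto simp: compose_eq)
  then obtain m where m: "m w \<in> P" "p (m w) = h w" "q (m w) = k w" if "w \<in> W" for w
    by metis
  show "\<exists>!m. m \<in> W \<rightarrow>\<^sub>E P \<and> compose W p m = h \<and> compose W q m = k"
  proof (intro ex1I conjI)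
    show "restrict m W \<in> W \<rightarrow>\<^sub>E P" using m(1) by auto
    show "compose W p (restrict m W) = h"
      by (rule eq_composeI[OF h, symmetric]) (simp add: m(2))
    show "compose W q (restrict m W) = k"
      by (rule eq_composeI[OF k, symmetric]) (simp add: m(3))
    fix n assume n: "n \<in> W \<rightarrow>\<^sub>E P \<and> compose W p n = h \<and> compose W q n = k"
    show "n = restrict m W"
    proof (rule PiE_ext)
      show "n \<in> W \<rightarrow>\<^sub>E P" "restrict m W \<in> W \<rightarrow>\<^sub>E P" using n m(1) by auto
      fix w assume w: "w \<in> W"
      then have "p (n w) = p (m w)" using n m(2)[OF w] by (auto simp: compose_eq)
      then show "n w = restrict m W w"
        using inj w n m(1) by (auto dest: inj_onD)
    qed
  qed
qed

text \<open>
  An element whose support lies in \<open>S\<close> is the image of an element of \<open>R S\<close>, so its value under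
  \<open>\<tau>\<close> comes from \<open>S\<close> as well.
\<close>

lemma natural_supp_subset:
  fixes R V :: "'u::set_universe san_mnd"
  assumes "semi_analytic R" "semi_analytic V" "natural R V \<tau>" "small X" "t \<in> Ob R X"
  shows "supp V X (\<tau> X t) \<subseteq> supp R X t"
proof -
  interpret R: semi_analytic R by fact
  interpret V: semi_analytic V by fact
  let ?S = "supp R X t"
  have sub: "?S \<subseteq> X" using R.supp_subset assms by blast
  have sm: "small ?S" using small_subset[OF assms(4) sub] .
  have inc: "idt ?S \<in> ?S \<rightarrow>\<^sub>E X" "inj_on (idt ?S) ?S" using sub by (auto simp: inj_on_def)
  obtain c where c: "c \<in> Ob R ?S" "Ar R ?S X (idt ?S) c = t"
    using R.supp_in_image[OF sm assms(4) inc assms(5)] by auto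
  have "\<tau> X t = Ar V ?S X (idt ?S) (\<tau> ?S c)"
    using naturalD[OF assms(3) sm assms(4) inc(1) c(1)] c(2) by simp
  moreover have \<tau>c: "\<tau> ?S c \<in> Ob V ?S" using natural_in[OF assms(3) sm c(1)] .
  ultimately have "supp V X (\<tau> X t) = idt ?S ` supp V ?S (\<tau> ?S c)"
    using V.supp_Ar[OF sm assms(4) inc(1)] by simp
  then show ?thesis using V.supp_subset[OF sm \<tau>c] by auto
qed

text \<open>
  If \<open>\<tau>\<close> is semi-cartesian, then the pullback square at the inclusion of the support of \<open>\<tau> t\<close> shows that
  \<open>t\<close> comes from that support. Conversely, let \<open>\<tau> a = V(f)(b)\<close> with \<open>f\<close> injective. If \<open>\<tau>\<close> preserves supports,
  then the support of \<open>a\<close> lies in the image of \<open>f\<close>, so \<open>a = R(f)(c)\<close>, and injectivity of \<open>V(f)\<close> gives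
  \<open>\<tau> c = b\<close>; injectivity of \<open>R(f)\<close> gives uniqueness.
\<close>

lemma semi_cartesian_iff_supp:
  fixes R V :: "'u::set_universe san_mnd"
  assumes "semi_analytic R" "semi_analytic V" "natural R V \<tau>"
  shows "semi_cartesian R V \<tau> \<longleftrightarrow>
    (\<forall>X. small X \<longrightarrow> (\<forall>t\<in>Ob R X. supp V X (\<tau> X t) = supp R X t))" (is "_ \<longleftrightarrow> ?pres")
proof
  interpret R: semi_analytic R by fact
  interpret V: semi_analytic V by fact
  show ?pres if sc: "semi_cartesian R V \<tau>"
  proof (intro allI impI ballI)
    fix X :: "'u set" and t assume X: "small X" and t: "t \<in> Ob R X"
    let ?S = "supp V X (\<tau> X t)"
    have \<tau>t: "\<tau> X t \<in> Ob V X" using natural_in[OF assms(3) X t] .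
    have sub: "?S \<subseteq> X" using V.supp_subset[OF X \<tau>t] .
    have sm: "small ?S" using small_subset[OF X sub] .
    have inc: "idt ?S \<in> ?S \<rightarrow>\<^sub>E X" "inj_on (idt ?S) ?S" using sub by (auto simp: inj_on_def)
    obtain d where d: "d \<in> Ob V ?S" "Ar V ?S X (idt ?S) d = \<tau> X t"
      using V.supp_in_image[OF sm X inc \<tau>t] by auto
    have "is_pullback (Ob R ?S) (Ob R X) (Ob V ?S) (Ob V X)
        (Ar R ?S X (idt ?S)) (\<tau> ?S) (\<tau> X) (Ar V ?S X (idt ?S))"
      using sc sm X inc unfolding semi_cartesian_def by blast
    then obtain c where c: "c \<in> Ob R ?S" "Ar R ?S X (idt ?S) c = t"
      using is_pullback_ex[OF _ t d(1)] d(2) by metis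
    have "supp R X t = idt ?S ` supp R ?S c"
      using R.supp_Ar[OF sm X inc(1) c(1)] c(2) by simp
    then have "supp R X t \<subseteq> ?S" using R.supp_subset[OF sm c(1)] by auto
    then show "?S = supp R X t" using natural_supp_subset[OF assms X t] by blast
  qed
  show "semi_cartesian R V \<tau>" if pres: ?pres
    unfolding semi_cartesian_def
  proof (intro conjI assms(3) allI ballI impI)
    fix X Y :: "'u set" and f assume f: "f \<in> X \<rightarrow>\<^sub>E Y" and *: "small X \<and> small Y \<and> inj_on f X"
    show "is_pullback (Ob R X) (Ob R Y) (Ob V X) (Ob V Y) (Ar R X Y f) (\<tau> X) (\<tau> Y) (Ar V X Y f)"
    proof (rule is_pullbackI)
      show "Ar R X Y f \<in> Ob R X \<rightarrow>\<^sub>E Ob R Y" "Ar V X Y f \<in> Ob V X \<rightarrow>\<^sub>E Ob V Y"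
        using R.Ar_mor[OF _ _ f] V.Ar_mor[OF _ _ f] * by auto
      show "\<tau> X \<in> Ob R X \<rightarrow>\<^sub>E Ob V X" "\<tau> Y \<in> Ob R Y \<rightarrow>\<^sub>E Ob V Y"
        "compose (Ob R X) (\<tau> Y) (Ar R X Y f) = compose (Ob R X) (Ar V X Y f) (\<tau> X)"
        using assms(3) f * unfolding natural_def by blast+
      show "inj_on (Ar R X Y f) (Ob R X)" using R.inj_Ar f * by blast
      fix a b assume a: "a \<in> Ob R Y" and b: "b \<in> Ob V X" and eq: "\<tau> Y a = Ar V X Y f b"
      have "supp R Y a = f ` supp V X b"
        using pres a * eq V.supp_Ar[OF _ _ f b] by metis
      then have "supp R Y a \<subseteq> f ` X" using V.supp_subset[OF _ b] * by blast
      then obtain c where c: "c \<in> Ob R X" "Ar R X Y f c = a"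
        using R.supp_in_image[OF _ _ f _ a] * by blast
      have "Ar V X Y f (\<tau> X c) = Ar V X Y f b"
        using naturalD[OF assms(3) _ _ f c(1)] c(2) eq * by simp
      then have "\<tau> X c = b"
        using V.inj_Ar[OF _ _ f] * natural_in[OF assms(3) _ c(1)] b by (auto dest: inj_onD)
      then show "\<exists>c\<in>Ob R X. Ar R X Y f c = a \<and> \<tau> X c = b" using c by blast
    qed
  qed
qed

section \<open>Plonka sums\<close>

lemma is_join_Join:
  assumes "suplattice A le" "U \<subseteq> A"
  shows "is_join A le U (Join A le U)"
proof -
  have "antisym le" using assms(1) by (simp add: suplattice_def partial_order_on_def)
  then have "v = w" if "is_join A le U v" "is_join A le U w" for v w
    using that by (auto simp: is_join_def antisym_def)
  moreover obtain v where "is_join A le U v" using assms by (auto simp: suplattice_def)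
  ultimately show ?thesis unfolding Join_def by (metis theI)
qed

text \<open>
  This is what makes the maps \<open>\<lambda>\<close> well defined. It refers to no monad, so it covers a diagram of
  \<open>V\<close>-algebras and the induced diagram of \<open>R\<close>-algebras alike.
\<close>

definition set_diagram :: "'u::set_universe set \<Rightarrow> 'u rel \<Rightarrow> 'u diagram \<Rightarrow> bool" where
  "set_diagram A le D \<longleftrightarrow>
     (\<forall>a\<in>A. small (Car D a)) \<and>
     (\<forall>u\<in>A. \<forall>v\<in>A. \<forall>m \<in> cp_hom A le u v. Hom D m \<in> Car D u \<rightarrow>\<^sub>E Car D v)"

lemma set_diagram_em_functor:
  assumes "em_functor T A le D"
  shows "set_diagram A le D"
proof -
  have "small (Car D a)" if "a \<in> A" for a
    using assms that by (cases "Alg D a") (auto simp: em_functor_def em_algebra_def)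
  moreover have "Hom D m \<in> Car D u \<rightarrow>\<^sub>E Car D v" if "u \<in> A" "v \<in> A" "m \<in> cp_hom A le u v" for u v m
  proof -
    have "em_hom T (Alg D u) (Alg D v) (Hom D m)"
      using assms that unfolding em_functor_def by blast
    then show ?thesis by (cases "Alg D u"; cases "Alg D v") (simp add: em_hom_def)
  qed
  ultimately show ?thesis unfolding set_diagram_def by blast
qed

lemma Car_em_map_diagram [simp]: "Car (em_map_diagram R \<tau> D) a = Car D a"
  by (simp add: em_map_diagram_def em_map_def split: prod.split)

lemma Str_em_map_diagram:
  "Str (em_map_diagram R \<tau> D) a = compose (Ob R (Car D a)) (Str D a) (\<tau> (Car D a))"
  by (simp add: em_map_diagram_def em_map_def split: prod.split)

lemma Hom_em_map_diagram [simp]: "Hom (em_map_diagram R \<tau> D) = Hom D"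
  by (simp add: em_map_diagram_def)

lemma set_diagram_em_map_diagram [simp]: "set_diagram A le (em_map_diagram R \<tau> D) = set_diagram A le D"
  by (simp add: set_diagram_def)

text \<open>
  The vector \<open>i \<mapsto> F(\<psi>\<^sub>i)(x(i))\<close> along which \<open>\<lambda>\<close> moves all entries of \<open>x\<close> to the summand of their
  join.
\<close>

definition lam_vec :: "'u::set_universe set \<Rightarrow> 'u rel \<Rightarrow> 'u diagram \<Rightarrow> 'u \<Rightarrow> ('u \<Rightarrow> 'u) \<Rightarrow> 'u \<Rightarrow> 'u" where
  "lam_vec A le D \<kappa> x =
     (\<lambda>i\<in>std \<kappa>. Hom D ((\<lambda>i. ufst (x i)) ` std \<kappa>, ufst (x i)) (usnd (x i)))"

definition lam_index :: "'u::set_universe set \<Rightarrow> 'u rel \<Rightarrow> 'u \<Rightarrow> ('u \<Rightarrow> 'u) \<Rightarrow> 'u" where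
  "lam_index A le \<kappa> x = Join A le ((\<lambda>i. ufst (x i)) ` std \<kappa>)"

lemma coprodE:
  assumes "z \<in> coprod A X" shows "ufst z \<in> A" "usnd z \<in> X (ufst z)"
  using assms by (auto simp: coprod_def)

lemma lam_vec_in:
  assumes A: "suplattice A le" and D: "set_diagram A le D" and x: "x \<in> std \<kappa> \<rightarrow>\<^sub>E coprod A (Car D)"
  shows "lam_index A le \<kappa> x \<in> A"
    and "lam_vec A le D \<kappa> x \<in> std \<kappa> \<rightarrow>\<^sub>E Car D (lam_index A le \<kappa> x)"
proof -
  let ?U = "(\<lambda>i. ufst (x i)) ` std \<kappa>"
  have z: "ufst (x i) \<in> A" "usnd (x i) \<in> Car D (ufst (x i))" if "i \<in> std \<kappa>" for i
    using x that by (auto dest: coprodE)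
  then have U: "?U \<subseteq> A" by auto
  then show b: "lam_index A le \<kappa> x \<in> A"
    using is_join_Join[OF A U] by (auto simp: is_join_def lam_index_def)
  have "Hom D (?U, ufst (x i)) (usnd (x i)) \<in> Car D (lam_index A le \<kappa> x)" if i: "i \<in> std \<kappa>" for i
  proof -
    have "(?U, ufst (x i)) \<in> cp_hom A le (ufst (x i)) (lam_index A le \<kappa> x)"
      using U i by (auto simp: cp_hom_def lam_index_def)
    then have "Hom D (?U, ufst (x i)) \<in> Car D (ufst (x i)) \<rightarrow>\<^sub>E Car D (lam_index A le \<kappa> x)"
      using D z(1)[OF i] b unfolding set_diagram_def by blast
    then show ?thesis using z(2)[OF i] by (rule PiE_mem)
  qed
  then show "lam_vec A le D \<kappa> x \<in> std \<kappa> \<rightarrow>\<^sub>E Car D (lam_index A le \<kappa> x)"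
    by (auto simp: lam_vec_def)
qed

lemma lam_permute:
  assumes "\<sigma> \<in> Perm \<kappa>"
  shows "lam_index A le \<kappa> (compose (std \<kappa>) x \<sigma>) = lam_index A le \<kappa> x"
    and "lam_vec A le D \<kappa> (compose (std \<kappa>) x \<sigma>) = compose (std \<kappa>) (lam_vec A le D \<kappa> x) \<sigma>"
proof -
  have \<sigma>: "\<sigma> ` std \<kappa> = std \<kappa>" "\<And>i. i \<in> std \<kappa> \<Longrightarrow> \<sigma> i \<in> std \<kappa>"
    using assms by (auto simp: bij_betw_def)
  have "(\<lambda>i. ufst (compose (std \<kappa>) x \<sigma> i)) ` std \<kappa> = (\<lambda>i. ufst (x i)) ` \<sigma> ` std \<kappa>"
    by (simp add: compose_eq image_image cong: image_cong)
  then have U: "(\<lambda>i. ufst (compose (std \<kappa>) x \<sigma> i)) ` std \<kappa> = (\<lambda>i. ufst (x i)) ` std \<kappa>"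
    by (simp add: \<sigma>)
  then show "lam_index A le \<kappa> (compose (std \<kappa>) x \<sigma>) = lam_index A le \<kappa> x"
    by (simp add: lam_index_def)
  show "lam_vec A le D \<kappa> (compose (std \<kappa>) x \<sigma>) = compose (std \<kappa>) (lam_vec A le D \<kappa> x) \<sigma>"
    unfolding lam_vec_def U by (rule ext) (simp add: compose_def \<sigma>)
qed

context semi_analytic
begin

context
  fixes A :: "'u set" and le :: "'u rel" and D :: "'u diagram"
  assumes A: "suplattice A le" and D: "set_diagram A le D"
begin

lemma small_sum: "small (coprod A (Car D))"
  using A D by (intro small_coprod) (auto simp: suplattice_def set_diagram_def)

text \<open>
  The formula for \<open>\<lambda>\<close> holds for every representative. Two representatives differ by a permutation,
  which changes neither the set of indices of the entries nor, by \<open>delt_permute\<close>, the resulting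
  element.
\<close>

lemma lam_elt:
  assumes raw: "(\<kappa>, x, r) \<in> san_raw (Coef T) (coprod A (Car D))"
  shows "lam T A le D (elt T (coprod A (Car D)) \<kappa> x r) =
    upair (lam_index A le \<kappa> x) (delt T (Car D (lam_index A le \<kappa> x)) \<kappa> (lam_vec A le D \<kappa> x) r)"
proof -
  let ?C = "coprod A (Car D)"
  let ?w = "\<lambda>\<kappa> x r. upair (lam_index A le \<kappa> x)
    (delt T (Car D (lam_index A le \<kappa> x)) \<kappa> (lam_vec A le D \<kappa> x) r)"
  have eq: "?w \<kappa>' x' r' = ?w \<kappa> x r"
    if raw': "(\<kappa>', x', r') \<in> san_raw (Coef T) ?C" and e: "elt T ?C \<kappa> x r = elt T ?C \<kappa>' x' r'"
    for \<kappa>' x' r'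
  proof -
    obtain \<sigma> where \<sigma>: "\<kappa>' = \<kappa>" "\<sigma> \<in> Perm \<kappa>" "x = compose (std \<kappa>) x' \<sigma>"
      "r' = Ca (Coef T) \<kappa> \<kappa> \<sigma> r"
      using elt_eqE[OF small_sum e raw raw'] .
    have x': "x' \<in> std \<kappa> \<rightarrow>\<^sub>E ?C" "cardinal \<kappa>" "r \<in> Co (Coef T) \<kappa>"
      using raw raw' \<sigma>(1) by (auto simp: san_raw_def Inj_def)
    have sm: "small (Car D (lam_index A le \<kappa> x'))"
      using lam_vec_in(1)[OF A D x'(1)] D by (auto simp: set_diagram_def)
    show ?thesis
      unfolding \<sigma> lam_permute[OF \<sigma>(2)]
      using delt_permute[OF sm x'(2,3) lam_vec_in(2)[OF A D x'(1)] \<sigma>(2)] by simp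
  qed
  have "lam T A le D (elt T ?C \<kappa> x r) = (THE w. \<exists>\<kappa>' x' r'. (\<kappa>', x', r') \<in> san_raw (Coef T) ?C \<and>
      elt T ?C \<kappa> x r = elt T ?C \<kappa>' x' r' \<and> w = ?w \<kappa>' x' r')"
    using elt_in[OF small_sum raw] by (simp add: lam_def Let_def lam_index_def lam_vec_def)
  also have "\<dots> = ?w \<kappa> x r"
    by (rule the_equality) (use raw eq in blast)+
  finally show ?thesis .
qed

lemma plonka_sum_elt:
  assumes raw: "(\<kappa>, x, r) \<in> san_raw (Coef T) (coprod A (Car D))"
  shows "snd (plonka_sum T A le D) (elt T (coprod A (Car D)) \<kappa> x r) =
    upair (lam_index A le \<kappa> x)
      (Str D (lam_index A le \<kappa> x) (delt T (Car D (lam_index A le \<kappa> x)) \<kappa> (lam_vec A le D \<kappa> x) r))"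
proof -
  have x: "x \<in> std \<kappa> \<rightarrow>\<^sub>E coprod A (Car D)" "cardinal \<kappa>" "r \<in> Co (Coef T) \<kappa>"
    using raw by (auto simp: san_raw_def Inj_def)
  note b = lam_vec_in(1)[OF A D x(1)] and vec = lam_vec_in(2)[OF A D x(1)]
  have "small (Car D (lam_index A le \<kappa> x))"
    using b D by (auto simp: set_diagram_def)
  then have "delt T (Car D (lam_index A le \<kappa> x)) \<kappa> (lam_vec A le D \<kappa> x) r
      \<in> Ob T (Car D (lam_index A le \<kappa> x))"
    using delt_in vec x(2,3) by blast
  then have "upair (lam_index A le \<kappa> x) (delt T (Car D (lam_index A le \<kappa> x)) \<kappa> (lam_vec A le D \<kappa> x) r)
      \<in> coprod A (\<lambda>a. Ob T (Car D a))"
    using b unfolding coprod_def by blast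
  then show ?thesis
    using elt_in[OF small_sum raw]
    by (simp add: plonka_sum_def compose_eq coprod_map_def lam_elt[OF raw])
qed

text \<open>
  The summand in which a Plonka sum takes its value is determined by the support alone.
\<close>

lemma plonka_sum_index:
  assumes t: "t \<in> Ob T (coprod A (Car D))"
  shows "ufst (snd (plonka_sum T A le D) t) = Join A le (ufst ` supp T (coprod A (Car D)) t)"
proof (rule Ob_cases[OF small_sum t])
  fix \<kappa> x r assume "(\<kappa>, x, r) \<in> san_raw (Coef T) (coprod A (Car D))" "t = elt T (coprod A (Car D)) \<kappa> x r"
  then show ?thesis
    by (simp add: plonka_sum_elt supp_elt[OF small_sum] lam_index_def image_image)
qed

end

end

section \<open>Preservation of supports implies preservation of Plonka sums\<close>

text \<open>
  The generic element \<open>[1, r]\<close> has full support, so its image under \<open>\<tau>\<close> is \<open>[y, v]\<close> with \<open>y\<close> a permutation,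
  that is, again of the form \<open>[1, r']\<close>. By naturality \<open>\<tau>\<close> then maps every \<open>\<langle>\<langle>g, r\<rangle>\<rangle>\<close> to \<open>\<langle>\<langle>g, r'\<rangle>\<rangle>\<close>.
\<close>

lemma supp_preserving_on_generic:
  fixes R V :: "'u::set_universe san_mnd"
  assumes "semi_analytic R" "semi_analytic V" "natural R V \<tau>"
    and pres: "\<And>X t. small X \<Longrightarrow> t \<in> Ob R X \<Longrightarrow> supp V X (\<tau> X t) = supp R X t"
    and \<kappa>: "cardinal \<kappa>" and r: "r \<in> Co (Coef R) \<kappa>"
  obtains r' where "r' \<in> Co (Coef V) \<kappa>"
    "\<And>X g. small X \<Longrightarrow> g \<in> std \<kappa> \<rightarrow>\<^sub>E X \<Longrightarrow> \<tau> X (delt R X \<kappa> g r) = delt V X \<kappa> g r'"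
proof -
  interpret R: semi_analytic R by fact
  interpret V: semi_analytic V by fact
  let ?K = "std \<kappa>"
  let ?e = "elt R ?K \<kappa> (idt ?K) r"
  note raw = R.raw_generic[OF \<kappa> r]
  note e = R.elt_in[OF small_std raw]
  obtain \<kappa>' y v where raw': "(\<kappa>', y, v) \<in> san_raw (Coef V) ?K" and \<tau>e: "\<tau> ?K ?e = elt V ?K \<kappa>' y v"
    using V.Ob_cases[OF small_std natural_in[OF assms(3) small_std e]] .
  have y: "y \<in> std \<kappa>' \<rightarrow>\<^sub>E ?K" "inj_on y (std \<kappa>')" "cardinal \<kappa>'" "v \<in> Co (Coef V) \<kappa>'"
    using raw' by (auto simp: san_raw_def Inj_def)
  have "y ` std \<kappa>' = ?K"
    using pres[OF small_std e] R.supp_elt[OF small_std raw] V.supp_elt[OF small_std raw'] \<tau>e by simp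
  then have b: "bij_betw y (std \<kappa>') ?K" using y(2) by (simp add: bij_betw_def)
  then have k: "\<kappa>' = \<kappa>"
    using cardinal_unique[OF y(3) \<kappa>] unfolding eqpoll_def by blast
  have P: "y \<in> Perm \<kappa>" using b y(1) k by simp
  let ?r' = "Ca (Coef V) \<kappa> \<kappa> y v"
  have v: "v \<in> Co (Coef V) \<kappa>" using y k by simp
  have r': "?r' \<in> Co (Coef V) \<kappa>"
    using Ca_in[OF V.coeff \<kappa> \<kappa> Perm_Surj[OF P] v] .
  have "compose ?K (idt ?K) y = y"
    by (rule eq_composeI[symmetric]) (use P in auto)
  then have \<tau>e': "\<tau> ?K ?e = elt V ?K \<kappa> (idt ?K) ?r'"
    using V.elt_permute[OF V.raw_generic[OF \<kappa> v] P] \<tau>e k by simp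
  have "\<tau> X (delt R X \<kappa> g r) = delt V X \<kappa> g ?r'" if "small X" "g \<in> ?K \<rightarrow>\<^sub>E X" for X g
    using naturalD[OF assms(3) small_std that e] \<tau>e' by (simp add: delt_def)
  with r' show ?thesis by (rule that)
qed

text \<open>
  Since \<open>\<tau>\<close> replaces only the coefficient \<open>r\<close> of \<open>[x, r]\<close>, it changes neither the index of the
  summand nor the vector to which \<open>\<lambda>\<close> moves \<open>x\<close>.
\<close>

lemma preserves_plonka_sums_if_supp:
  fixes R V :: "'u::set_universe san_mnd"
  assumes "semi_analytic R" "semi_analytic V" "natural R V \<tau>"
    and pres: "\<And>X t. small X \<Longrightarrow> t \<in> Ob R X \<Longrightarrow> supp V X (\<tau> X t) = supp R X t"
  shows "preserves_plonka_sums R V \<tau>"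
  unfolding preserves_plonka_sums_def
proof (intro allI impI, elim conjE)
  interpret R: semi_analytic R by fact
  interpret V: semi_analytic V by fact
  fix A :: "'u set" and le and D :: "'u diagram"
  assume A: "suplattice A le" and "em_functor V A le D"
  then have D: "set_diagram A le D" by (intro set_diagram_em_functor)
  let ?D' = "em_map_diagram R \<tau> D" and ?C = "coprod A (Car D)"
  have C: "small ?C" by (rule R.small_sum[OF A D])
  have "snd (plonka_sum R A le ?D') t = snd (plonka_sum V A le D) (\<tau> ?C t)" if t: "t \<in> Ob R ?C" for t
  proof (rule R.Ob_cases[OF C t])
    fix \<kappa> x r assume raw: "(\<kappa>, x, r) \<in> san_raw (Coef R) ?C" and t: "t = elt R ?C \<kappa> x r"
    then have x: "x \<in> std \<kappa> \<rightarrow>\<^sub>E ?C" "cardinal \<kappa>" "r \<in> Co (Coef R) \<kappa>" "x \<in> Inj \<kappa> ?C"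
      by (auto simp: san_raw_def Inj_def)
    obtain r' where r': "r' \<in> Co (Coef V) \<kappa>"
      and \<tau>: "\<And>X g. small X \<Longrightarrow> g \<in> std \<kappa> \<rightarrow>\<^sub>E X \<Longrightarrow> \<tau> X (delt R X \<kappa> g r) = delt V X \<kappa> g r'"
      using supp_preserving_on_generic[OF assms x(2,3)] by blast
    have raw': "(\<kappa>, x, r') \<in> san_raw (Coef V) ?C" using x r' by (simp add: san_raw_def)
    have \<tau>t: "\<tau> ?C t = elt V ?C \<kappa> x r'"
      using \<tau>[OF C x(1)] by (simp add: t R.delt_eq_elt[OF C raw] V.delt_eq_elt[OF C raw'])
    let ?b = "lam_index A le \<kappa> x" and ?g = "lam_vec A le D \<kappa> x"
    note vec = lam_vec_in[OF A D x(1)]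
    have sm: "small (Car D ?b)" using vec(1) D by (auto simp: set_diagram_def)
    have "snd (plonka_sum R A le ?D') t = upair ?b (Str ?D' ?b (delt R (Car D ?b) \<kappa> ?g r))"
      using R.plonka_sum_elt[OF A, of ?D'] D raw by (simp add: t lam_vec_def)
    also have "\<dots> = upair ?b (Str D ?b (\<tau> (Car D ?b) (delt R (Car D ?b) \<kappa> ?g r)))"
      using R.delt_in[OF sm vec(2) x(2,3)] by (simp add: Str_em_map_diagram compose_eq)
    also have "\<dots> = snd (plonka_sum V A le D) (\<tau> ?C t)"
      by (simp add: \<tau>[OF sm vec(2)] \<tau>t V.plonka_sum_elt[OF A D raw'])
    finally show ?thesis .
  qed
  moreover have "snd (plonka_sum R A le ?D') t = undefined" if "t \<notin> Ob R ?C" for t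
    using that by (simp add: plonka_sum_def compose_def)
  ultimately have "snd (plonka_sum R A le ?D') = compose (Ob R ?C) (snd (plonka_sum V A le D)) (\<tau> ?C)"
    by (intro ext) (simp add: compose_def)
  then show "plonka_sum R A le ?D' = em_map R \<tau> (plonka_sum V A le D)"
    by (simp add: plonka_sum_def em_map_def)
qed

section \<open>A Plonka sum that detects supports\<close>

definition chain2 :: "'u::set_universe \<Rightarrow> 'u rel" where
  "chain2 a = {(bot, bot), (bot, a), (a, a)}"

lemma suplattice_chain2:
  assumes "a \<noteq> bot"
  shows "suplattice {bot, a} (chain2 a)"
proof -
  have "partial_order_on {bot, a} (chain2 a)"
    using assms by (auto simp: partial_order_on_def preorder_on_def refl_on_def trans_def
        antisym_def chain2_def)
  moreover have "is_join {bot, a} (chain2 a) U (if a \<in> U then a else bot)" if "U \<subseteq> {bot, a}" for U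
    using that by (auto simp: is_join_def chain2_def)
  ultimately show ?thesis
    unfolding suplattice_def by (auto simp: small_finite)
qed

lemma Join_chain2:
  assumes "a \<noteq> bot" "U \<subseteq> {bot, a}"
  shows "Join {bot, a} (chain2 a) U = (if a \<in> U then a else bot)"
  using is_join_Join[OF suplattice_chain2[OF assms(1)] assms(2)] assms
  by (auto simp: is_join_def chain2_def split: if_splits)

definition terminal_alg :: "'u::set_universe san_mnd \<Rightarrow> 'u set \<times> ('u \<Rightarrow> 'u)" where
  "terminal_alg T = ({bot}, \<lambda>t\<in>Ob T {bot}. bot)"

text \<open>
  All equations are between maps into a one-element set, which makes the constant diagram at the
  terminal algebra functorial for every \<open>A\<close>.
\<close>

lemma em_functor_terminal:
  fixes T :: "'u::set_universe san_mnd"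
  assumes "monad T"
  shows "em_functor T A le \<lparr>Alg = (\<lambda>_. terminal_alg T), Hom = (\<lambda>_. idt {bot})\<rparr>"
proof -
  let ?B = "{bot :: 'u}" and ?\<beta> = "\<lambda>t\<in>Ob T {bot}. bot"
  have sm: "small ?B" by (simp add: small_finite)
  have T: "endofunctor T" "natural id_endo T (Eta T)" "natural (comp_endo T T) T (Mu T)"
    using assms by (auto simp: monad_def)
  have smT: "small (Ob T ?B)" using T(1) sm unfolding endofunctor_def by blast
  have \<beta>: "?\<beta> \<in> Ob T ?B \<rightarrow>\<^sub>E ?B" by auto
  have eta: "Eta T ?B \<in> ?B \<rightarrow>\<^sub>E Ob T ?B" 
    using T(2) sm unfolding natural_def id_endo_def by auto
  have mu: "Mu T ?B \<in> Ob T (Ob T ?B) \<rightarrow>\<^sub>E Ob T ?B"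
    using T(3) sm unfolding natural_def comp_endo_def by auto
  have ar\<beta>: "Ar T (Ob T ?B) ?B ?\<beta> \<in> Ob T (Ob T ?B) \<rightarrow>\<^sub>E Ob T ?B"
    using T(1) smT sm \<beta> unfolding endofunctor_def by blast
  have arid: "Ar T ?B ?B (idt ?B) = idt (Ob T ?B)"
    using T(1) sm unfolding endofunctor_def by blast
  have "em_algebra T (terminal_alg T)"
    using sm eta mu ar\<beta> unfolding em_algebra_def terminal_alg_def
    by (auto simp: compose_def intro!: restrict_ext)
  moreover have "em_hom T (terminal_alg T) (terminal_alg T) (idt ?B)"
    unfolding em_hom_def terminal_alg_def using arid
    by (auto simp: compose_def intro!: restrict_ext)
  moreover have "idt ?B = compose ?B (idt ?B) (idt ?B)" by (auto simp: compose_def)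
  ultimately show ?thesis
    unfolding em_functor_def by (simp add: terminal_alg_def)
qed

text \<open>
  Over the two-element chain, the Plonka sum of terminal algebras is a copy of the chain, and its structure
  map sends an element to the join of its support. If \<open>i\<close> lies in the support of \<open>t\<close> but not in that of
  \<open>\<tau> t\<close>, then colouring \<open>i\<close> by the top and all other elements by the bottom tells the two structures
  apart. (A support without \<open>i\<close> may be empty; its join is then the bottom as well.)
\<close>

lemma supp_if_preserves_plonka_sums:
  fixes R V :: "'u::set_universe san_mnd"
  assumes "semi_analytic R" "semi_analytic V" "natural R V \<tau>" "monad V"
    and pres: "preserves_plonka_sums R V \<tau>" and X: "small X" and t: "t \<in> Ob R X"
  shows "supp V X (\<tau> X t) = supp R X t"
proof (rule ccontr)
  interpret R: semi_analytic R by fact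
  interpret V: semi_analytic V by fact
  assume "supp V X (\<tau> X t) \<noteq> supp R X t"
  then obtain i where i: "i \<in> supp R X t" "i \<notin> supp V X (\<tau> X t)"
    using natural_supp_subset[OF assms(1-3) X t] by blast
  obtain a :: 'u where a: "a \<noteq> bot"
    using infinite_universe by (metis finite.simps UNIV_eq_I singletonI)
  define A where "A = {bot, a}"
  define D :: "'u diagram" where "D = \<lparr>Alg = (\<lambda>_. terminal_alg V), Hom = (\<lambda>_. idt {bot})\<rparr>"
  define C where "C = coprod A (Car D)"
  define \<chi> where "\<chi> = (\<lambda>j\<in>X. upair (if j = i then a else bot) bot)"
  let ?D' = "em_map_diagram R \<tau> D"
  have A: "suplattice A (chain2 a)" unfolding A_def by (rule suplattice_chain2[OF a])
  have em: "em_functor V A (chain2 a) D" unfolding D_def by (rule em_functor_terminal[OF assms(4)])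
  have D: "set_diagram A (chain2 a) D" by (rule set_diagram_em_functor[OF em])
  then have D': "set_diagram A (chain2 a) ?D'" by simp
  have C: "small C" unfolding C_def by (rule R.small_sum[OF A D])
  have \<chi>: "\<chi> \<in> X \<rightarrow>\<^sub>E C"
    by (auto simp: \<chi>_def C_def coprod_def A_def D_def terminal_alg_def)
  let ?s = "Ar R X C \<chi> t"
  have s: "?s \<in> Ob R C" using R.Ar_in[OF X C \<chi> t] .
  have \<tau>s: "\<tau> C ?s \<in> Ob V C" by (rule natural_in[OF assms(3) C s])
  have idx: "Join A (chain2 a) (ufst ` \<chi> ` S) = (if i \<in> S then a else bot)" if "S \<subseteq> X" for S
  proof -
    have "ufst ` \<chi> ` S = (\<lambda>j. if j = i then a else bot) ` S"
      unfolding image_image using that by (intro image_cong) (auto simp: \<chi>_def)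
    moreover have "\<dots> \<subseteq> {bot, a}" "a \<in> \<dots> \<longleftrightarrow> i \<in> S"
      using a by (auto simp: image_iff split: if_splits)
    ultimately show ?thesis using Join_chain2[OF a] by (simp add: A_def)
  qed
  have "plonka_sum R A (chain2 a) ?D' = em_map R \<tau> (plonka_sum V A (chain2 a) D)"
    using pres A em unfolding preserves_plonka_sums_def by blast
  then have "snd (plonka_sum R A (chain2 a) ?D') ?s = snd (plonka_sum V A (chain2 a) D) (\<tau> C ?s)"
    using s by (simp add: em_map_def plonka_sum_def compose_eq C_def)
  moreover have "ufst (snd (plonka_sum R A (chain2 a) ?D') ?s) = a"
    using R.plonka_sum_index[OF A D', of ?s] s R.supp_Ar[OF X C \<chi> t] idx[OF R.supp_subset[OF X t]] i
    by (simp add: C_def)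
  moreover have "ufst (snd (plonka_sum V A (chain2 a) D) (\<tau> C ?s)) = bot"
  proof -
    note \<tau>t = natural_in[OF assms(3) X t]
    have "supp V C (\<tau> C ?s) = \<chi> ` supp V X (\<tau> X t)"
      using naturalD[OF assms(3) X C \<chi> t] V.supp_Ar[OF X C \<chi> \<tau>t] by simp
    then show ?thesis
      using V.plonka_sum_index[OF A D, of "\<tau> C ?s"] \<tau>s idx[OF V.supp_subset[OF X \<tau>t]] i
      by (simp add: C_def)
  qed
  ultimately show False using a by simp
qed

theorem theorem5p6:
  fixes R V :: "'u::set_universe san_mnd" and \<tau> :: "'u set \<Rightarrow> 'u \<Rightarrow> 'u"
  assumes "sanmnd R" and "sanmnd V" and "monad_morphism R V \<tau>"
  shows "semi_cartesian R V \<tau> \<longleftrightarrow> preserves_plonka_sums R V \<tau>"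
proof -
  have R: "semi_analytic R" and V: "semi_analytic V" and mV: "monad V"
    using assms by (auto simp: sanmnd_def monad_def semi_analytic_def)
  have nat: "natural R V \<tau>" using assms(3) by (simp add: monad_morphism_def)
  show ?thesis
    unfolding semi_cartesian_iff_supp[OF R V nat]
    using preserves_plonka_sums_if_supp[OF R V nat] supp_if_preserves_plonka_sums[OF R V nat mV] by blast
qed

end
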